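(* Let $E_u$ be a Dedekind complete Riesz space with strong order unit $u$, and let $T$ be a strictly positive conditional expectation on $E_u$ with $Tu=u$. Let $X_1,\dots,X_n$ be $T$-conditionally independent elements of $E_u$ such that, for each $i\in\{1,\dots,n\}$, $X_i$ is subGaussian with parameter $v_i$. Then for every real $t>0$, $$TP_{\left(\sum_{i=1}^n(X_i-T(X_i))-tu\right)^+}u\;\leq\;\exp\left(-\frac{t^2}{2\sum_{i=1}^n\|v_i\|_u}\right)u.$$
   Context: $E_u$ is a Dedekind complete Riesz space with strong order unit $u$. By the Yosida representation theorem there are a compact Hausdorff space $K$ and a Riesz isomorphism $\varphi:E_u\to C(K)$ with $\varphi(u)=1$; $E_u$ carries the $f$-algebra multiplication transported by $\varphi$, for which $u$ is the unit. The gauge norm is $\|x\|_u=\inf\{\beta\in\mathbb{R}: |x|\le\beta u\}$. Set $\exp(x)=\varphi^{-1}(\exp\circ\varphi(x))$ for $x\in E_u$ and $\log(x)=\varphi^{-1}(\log\circ\varphi(x))$ for positive invertible $x\in E_u$. A conditional expectation $T$ is a positive order continuous linear projection mapping weak order units to weak order units whose range $R(T)$ is a Dedekind complete Riesz subspace. It is strictly positive if $T|x|=0$ implies $x=0$. For $x\in E_u$, $P_{x^+}$ is the band projection onto the band generated by $x^+$. For $Y\in E_u$ and $\lambda\in\mathbb{R}$ put $\Psi_Y(\lambda)=\log(T(\exp(\lambda Y)))$. An element $X\in E_u$ is subGaussian with parameter $v$, where $v$ is an invertible element of $E_u$, if $\Psi_{X-T(X)}(\lambda)\le\frac{\lambda^2}{2}v$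 for all $\lambda\in\mathbb{R}$. Independence: band projections $P,Q$ are $T$-conditionally independent if $TPQu=TPu\cdot TQu$. Two Riesz subspaces $E_1,E_2$ are $T$-conditionally independent if all band projections $P_1,P_2$ with $P_iu\in E_i$ are $T$-conditionally independent. A family $(E_\lambda)_{\lambda\in\Lambda}$ of (order) closed Riesz subspaces containing $R(T)$ is $T$-conditionally independent if for every pair of disjoint subsets $\Lambda_1,\Lambda_2\subset\Lambda$ the closed Riesz subspaces generated by $\bigcup_{\lambda\in\Lambda_1}E_\lambda$ and by $\bigcup_{\lambda\in\Lambda_2}E_\lambda$ are $T$-conditionally independent. Elements $(X_i)$ are $T$-conditionally independent if the family of closed Riesz subspaces $\langle\{X_i\}\cup R(T)\rangle$ generated by $X_i$ and $R(T)$ is. *)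

theory Defs
  imports "HOL-Analysis.Analysis" "HOL-Library.Lattice_Algebras"
begin

text \<open>The modulus of a Riesz space element is \<open>\<bar>x\<bar>\<close> (axiom \<open>abs_lattice\<close>: \<open>\<bar>x\<bar> = sup x (- x)\<close>) and
  its positive part is \<open>pprt x = sup x 0\<close>.  Dedekind completeness is what
  \<^class>\<open>conditionally_complete_lattice\<close> expresses; \<open>Sup A\<close> and \<open>Inf A\<close> are meaningful only for
  nonempty \<open>A\<close> that is bounded on the relevant side.\<close>

class dedekind_complete_riesz_space =
  ordered_real_vector + lattice_ab_group_add_abs + conditionally_complete_lattice


section \<open>Order units, ideals, bands\<close>

definition strong_order_unit :: "'a::dedekind_complete_riesz_space \<Rightarrow> bool" where
  "strong_order_unit u \<longleftrightarrow> 0 \<le> u \<and> (\<forall>x. \<exists>\<beta>::real. \<bar>x\<bar> \<le> \<beta> *\<^sub>R u)"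

definition gauge_norm :: "'a::dedekind_complete_riesz_space \<Rightarrow> 'a \<Rightarrow> real" where
  "gauge_norm u x = Inf {\<beta>::real. \<bar>x\<bar> \<le> \<beta> *\<^sub>R u}"

definition riesz_subspace :: "'a::dedekind_complete_riesz_space set \<Rightarrow> bool" where
  "riesz_subspace E \<longleftrightarrow> subspace E \<and> (\<forall>x\<in>E. \<forall>y\<in>E. sup x y \<in> E \<and> inf x y \<in> E)"

text \<open>Suprema are taken inside \<open>E\<close> and need not agree with those of the ambient space.\<close>

definition dedekind_complete_subspace :: "'a::dedekind_complete_riesz_space set \<Rightarrow> bool" where
  "dedekind_complete_subspace E \<longleftrightarrow> riesz_subspace E \<and>
     (\<forall>S\<subseteq>E. S \<noteq> {} \<and> (\<exists>b\<in>E. \<forall>x\<in>S. x \<le> b) \<longrightarrow>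
        (\<exists>s\<in>E. (\<forall>x\<in>S. x \<le> s) \<and> (\<forall>b\<in>E. (\<forall>x\<in>S. x \<le> b) \<longrightarrow> s \<le> b)))"

definition order_ideal :: "'a::dedekind_complete_riesz_space set \<Rightarrow> bool" where
  "order_ideal A \<longleftrightarrow> subspace A \<and> (\<forall>x\<in>A. \<forall>y. \<bar>y\<bar> \<le> \<bar>x\<bar> \<longrightarrow> y \<in> A)"

definition band :: "'a::dedekind_complete_riesz_space set \<Rightarrow> bool" where
  "band B \<longleftrightarrow> order_ideal B \<and> (\<forall>S\<subseteq>B. S \<noteq> {} \<and> bdd_above S \<longrightarrow> Sup S \<in> B)"

definition band_generated :: "'a::dedekind_complete_riesz_space set \<Rightarrow> 'a set" where
  "band_generated S = \<Inter>{B. band B \<and> S \<subseteq> B}"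

definition disjoint_complement :: "'a::dedekind_complete_riesz_space set \<Rightarrow> 'a set" where
  "disjoint_complement B = {y. \<forall>x\<in>B. inf \<bar>x\<bar> \<bar>y\<bar> = 0}"

text \<open>In a Dedekind complete Riesz space every band \<open>B\<close> is a direct summand with complement
  \<open>disjoint_complement B\<close>, so the description below is proper for every band.\<close>

definition band_projection :: "'a::dedekind_complete_riesz_space set \<Rightarrow> 'a \<Rightarrow> 'a" where
  "band_projection B x = (THE b. b \<in> B \<and> x - b \<in> disjoint_complement B)"

definition is_band_projection :: "('a::dedekind_complete_riesz_space \<Rightarrow> 'a) \<Rightarrow> bool" where
  "is_band_projection P \<longleftrightarrow> (\<exists>B. band B \<and> P = band_projection B)"

definition weak_order_unit :: "'a::dedekind_complete_riesz_space \<Rightarrow> bool" where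
  "weak_order_unit e \<longleftrightarrow> 0 \<le> e \<and> band_generated {e} = UNIV"


section \<open>Order convergence\<close>

definition decreases_to_zero :: "'a::dedekind_complete_riesz_space set \<Rightarrow> bool" where
  "decreases_to_zero D \<longleftrightarrow>
     D \<noteq> {} \<and> (\<forall>x\<in>D. \<forall>y\<in>D. \<exists>z\<in>D. z \<le> x \<and> z \<le> y) \<and> bdd_below D \<and> Inf D = 0"

text \<open>Nets are represented by filters: a net \<open>(x\<^sub>\<alpha>)\<close> converges in order to \<open>l\<close> if some net decreasing
  to \<open>0\<close> has each of its terms eventually dominating \<open>\<bar>x\<^sub>\<alpha> - l\<bar>\<close>.  A net in the space itself may be
  replaced by its image filter, so no quantification over index types is needed below.\<close>

definition order_tendsto :: "('i \<Rightarrow> 'a::dedekind_complete_riesz_space) \<Rightarrow> 'a \<Rightarrow> 'i filter \<Rightarrow> bool" where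
  "order_tendsto f l F \<longleftrightarrow>
     (\<exists>D. decreases_to_zero D \<and> (\<forall>d\<in>D. eventually (\<lambda>i. \<bar>f i - l\<bar> \<le> d) F))"

definition order_continuous ::
  "('a::dedekind_complete_riesz_space \<Rightarrow> 'b::dedekind_complete_riesz_space) \<Rightarrow> bool" where
  "order_continuous T \<longleftrightarrow>
     (\<forall>(F::'a filter) l. order_tendsto (\<lambda>x. x) l F \<longrightarrow> order_tendsto T (T l) F)"

definition order_closed :: "'a::dedekind_complete_riesz_space set \<Rightarrow> bool" where
  "order_closed A \<longleftrightarrow>
     (\<forall>(F::'a filter) l. F \<noteq> bot \<and> eventually (\<lambda>x. x \<in> A) F \<and> order_tendsto (\<lambda>x. x) l F \<longrightarrow> l \<in> A)"

definition closed_riesz_subspace :: "'a::dedekind_complete_riesz_space set \<Rightarrow> bool" where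
  "closed_riesz_subspace E \<longleftrightarrow> riesz_subspace E \<and> order_closed E"

definition closed_riesz_subspace_generated :: "'a::dedekind_complete_riesz_space set \<Rightarrow> 'a set" where
  "closed_riesz_subspace_generated S = \<Inter>{E. closed_riesz_subspace E \<and> S \<subseteq> E}"


section \<open>Conditional expectations\<close>

definition conditional_expectation :: "('a::dedekind_complete_riesz_space \<Rightarrow> 'a) \<Rightarrow> bool" where
  "conditional_expectation T \<longleftrightarrow>
     linear T \<and> (\<forall>x. 0 \<le> x \<longrightarrow> 0 \<le> T x) \<and> order_continuous T \<and> (\<forall>x. T (T x) = T x) \<and>
     (\<forall>e. weak_order_unit e \<longrightarrow> weak_order_unit (T e)) \<and>
     dedekind_complete_subspace (range T)"

definition strictly_positive :: "('a::dedekind_complete_riesz_space \<Rightarrow> 'a) \<Rightarrow> bool" where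
  "strictly_positive T \<longleftrightarrow> (\<forall>x. T \<bar>x\<bar> = 0 \<longrightarrow> x = 0)"


section \<open>Yosida representation and functional calculus\<close>

text \<open>Elements of \<open>C(K)\<close> are extensional, i.e. \<open>undefined\<close> outside \<open>K\<close>, so that they are determined
  by their values on \<open>K\<close>.\<close>

definition continuous_functions :: "'k topology \<Rightarrow> ('k \<Rightarrow> real) set" where
  "continuous_functions K =
     {f. f \<in> extensional (topspace K) \<and> continuous_map K euclideanreal f}"

definition yosida_representation ::
  "'a::dedekind_complete_riesz_space \<Rightarrow> 'k topology \<Rightarrow> ('a \<Rightarrow> 'k \<Rightarrow> real) \<Rightarrow> bool" where
  "yosida_representation u K \<phi> \<longleftrightarrow>
     compact_space K \<and> Hausdorff_space K \<and>
     bij_betw \<phi> UNIV (continuous_functions K) \<and>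
     (\<forall>k\<in>topspace K.
        (\<forall>x y. \<phi> (x + y) k = \<phi> x k + \<phi> y k) \<and>
        (\<forall>c x. \<phi> (c *\<^sub>R x) k = c * \<phi> x k) \<and>
        (\<forall>x y. \<phi> (sup x y) k = max (\<phi> x k) (\<phi> y k)) \<and>
        (\<forall>x y. \<phi> (inf x y) k = min (\<phi> x k) (\<phi> y k)) \<and>
        \<phi> u k = 1)"

text \<open>A fixed choice of representation.  By Yosida's theorem one exists over the carrier type
  \<open>'a \<Rightarrow> real\<close> whenever \<open>u\<close> is a strong order unit: take for \<open>K\<close> the Riesz homomorphisms
  \<open>h :: 'a \<Rightarrow> real\<close> with \<open>h u = 1\<close>, with the topology of pointwise convergence, and evaluation for
  \<open>\<phi>\<close>.  Representations are unique up to homeomorphism of \<open>K\<close>, so nothing below depends on the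
  choice.\<close>

definition yosida ::
  "'a::dedekind_complete_riesz_space \<Rightarrow> ('a \<Rightarrow> real) topology \<times> ('a \<Rightarrow> ('a \<Rightarrow> real) \<Rightarrow> real)" where
  "yosida u = (SOME (K, \<phi>). yosida_representation u K \<phi>)"

definition yosida_space :: "'a::dedekind_complete_riesz_space \<Rightarrow> ('a \<Rightarrow> real) topology" where
  "yosida_space u = fst (yosida u)"

definition yosida_map :: "'a::dedekind_complete_riesz_space \<Rightarrow> 'a \<Rightarrow> ('a \<Rightarrow> real) \<Rightarrow> real" where
  "yosida_map u = snd (yosida u)"

definition yosida_inv :: "'a::dedekind_complete_riesz_space \<Rightarrow> (('a \<Rightarrow> real) \<Rightarrow> real) \<Rightarrow> 'a" where
  "yosida_inv u f = inv (yosida_map u) (restrict f (topspace (yosida_space u)))"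

definition riesz_mult :: "'a::dedekind_complete_riesz_space \<Rightarrow> 'a \<Rightarrow> 'a \<Rightarrow> 'a" where
  "riesz_mult u x y = yosida_inv u (\<lambda>k. yosida_map u x k * yosida_map u y k)"

definition riesz_exp :: "'a::dedekind_complete_riesz_space \<Rightarrow> 'a \<Rightarrow> 'a" where
  "riesz_exp u x = yosida_inv u (\<lambda>k. exp (yosida_map u x k))"

text \<open>Meaningful for positive invertible \<open>x\<close> only.\<close>

definition riesz_log :: "'a::dedekind_complete_riesz_space \<Rightarrow> 'a \<Rightarrow> 'a" where
  "riesz_log u x = yosida_inv u (\<lambda>k. ln (yosida_map u x k))"

definition riesz_invertible :: "'a::dedekind_complete_riesz_space \<Rightarrow> 'a \<Rightarrow> bool" where
  "riesz_invertible u x \<longleftrightarrow> (\<exists>y. riesz_mult u x y = u)"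


section \<open>SubGaussian elements\<close>

definition cond_log_mgf ::
  "'a::dedekind_complete_riesz_space \<Rightarrow> ('a \<Rightarrow> 'a) \<Rightarrow> 'a \<Rightarrow> real \<Rightarrow> 'a" where
  "cond_log_mgf u T Y s = riesz_log u (T (riesz_exp u (s *\<^sub>R Y)))"

definition subgaussian ::
  "'a::dedekind_complete_riesz_space \<Rightarrow> ('a \<Rightarrow> 'a) \<Rightarrow> 'a \<Rightarrow> 'a \<Rightarrow> bool" where
  "subgaussian u T X v \<longleftrightarrow> riesz_invertible u v \<and>
     (\<forall>s::real. cond_log_mgf u T (X - T X) s \<le> (s\<^sup>2 / 2) *\<^sub>R v)"


section \<open>Conditional independence\<close>

definition cond_indep_projections ::
  "'a::dedekind_complete_riesz_space \<Rightarrow> ('a \<Rightarrow> 'a) \<Rightarrow> ('a \<Rightarrow> 'a) \<Rightarrow> ('a \<Rightarrow> 'a) \<Rightarrow> bool" where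
  "cond_indep_projections u T P Q \<longleftrightarrow> T (P (Q u)) = riesz_mult u (T (P u)) (T (Q u))"

definition cond_indep_subspaces ::
  "'a::dedekind_complete_riesz_space \<Rightarrow> ('a \<Rightarrow> 'a) \<Rightarrow> 'a set \<Rightarrow> 'a set \<Rightarrow> bool" where
  "cond_indep_subspaces u T E1 E2 \<longleftrightarrow>
     (\<forall>P Q. is_band_projection P \<and> is_band_projection Q \<and> P u \<in> E1 \<and> Q u \<in> E2 \<longrightarrow>
        cond_indep_projections u T P Q)"

definition cond_indep_family ::
  "'a::dedekind_complete_riesz_space \<Rightarrow> ('a \<Rightarrow> 'a) \<Rightarrow> 'i set \<Rightarrow> ('i \<Rightarrow> 'a set) \<Rightarrow> bool" where
  "cond_indep_family u T I E \<longleftrightarrow>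
     (\<forall>i\<in>I. closed_riesz_subspace (E i) \<and> range T \<subseteq> E i) \<and>
     (\<forall>J1 J2. J1 \<subseteq> I \<and> J2 \<subseteq> I \<and> J1 \<inter> J2 = {} \<longrightarrow>
        cond_indep_subspaces u T
          (closed_riesz_subspace_generated (\<Union>i\<in>J1. E i))
          (closed_riesz_subspace_generated (\<Union>i\<in>J2. E i)))"

definition cond_indep_elements ::
  "'a::dedekind_complete_riesz_space \<Rightarrow> ('a \<Rightarrow> 'a) \<Rightarrow> 'i set \<Rightarrow> ('i \<Rightarrow> 'a) \<Rightarrow> bool" where
  "cond_indep_elements u T I X \<longleftrightarrow>
     cond_indep_family u T I (\<lambda>i. closed_riesz_subspace_generated ({X i} \<union> range T))"

end

theory Submission
  imports Defs
begin

text \<open>On \<open>C(K)\<close> this is the classical Chernoff argument.  Writing \<open>S\<close> for the centred sum, the component of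
  \<open>u\<close> in the band generated by \<open>(S - tu)\<^sup>+\<close> is dominated by \<open>exp (s (S - tu))\<close> for every \<open>s \<ge> 0\<close>, and
  \<open>T (exp (s S))\<close> factors into the conditional moment generating functions of the summands, whose subGaussian
  bounds give the claim at \<open>s = t / (\<Sum>i. gauge_norm u (v i))\<close>.

  For the factorization no averaging identity for \<open>T\<close> is needed.  Independence says that \<open>T\<close> is multiplicative
  on pairs of components of \<open>u\<close>, hence on their linear spans.  These are uniformly dense in the closed
  Riesz subspaces concerned, by a Freudenthal-type approximation, and \<open>T\<close> is a contraction for the uniform norm
  because \<open>T u = u\<close>.

  The functional calculus is an arbitrarily chosen Yosida representation, so one has to be constructed.  Minimal
  max-preserving sublinear functionals are Riesz homomorphisms, which yields enough points in the
  spectrum; for surjectivity, the preimage of a continuous function \<open>f\<close> is the supremum of all elements below \<open>f\<close>.\<close>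


section \<open>Max-preserving sublinear functionals\<close>

text \<open>The functionals below are those of the form \<open>x \<mapsto> max x(C)\<close> for closed subsets \<open>C\<close> of the spectrum;
  smaller functionals belong to smaller sets, and the minimal ones to points.\<close>

definition lattice_sublinear :: "('a::{real_vector,lattice} \<Rightarrow> real) \<Rightarrow> bool" where
  "lattice_sublinear p \<longleftrightarrow>
     (\<forall>x y. p (x + y) \<le> p x + p y) \<and>
     (\<forall>c>0. \<forall>x. p (c *\<^sub>R x) = c * p x) \<and>
     (\<forall>x y. p (sup x y) = max (p x) (p y))"

lemma lattice_sublinearD:
  assumes "lattice_sublinear p"
  shows "p (x + y) \<le> p x + p y" "c > 0 \<Longrightarrow> p (c *\<^sub>R x) = c * p x" "p (sup x y) = max (p x) (p y)"
  using assms by (auto simp: lattice_sublinear_def)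

lemma lattice_sublinear_zero:
  assumes "lattice_sublinear p"
  shows "p 0 = 0"
  using lattice_sublinearD(2)[OF assms, of 2 0] by simp

lemma lattice_sublinear_minus:
  assumes "lattice_sublinear p"
  shows "- p (- x) \<le> p x"
  using lattice_sublinearD(1)[OF assms, of x "- x"] lattice_sublinear_zero[OF assms] by simp

text \<open>Directedness lets one index serve two near-optimal choices at once, which settles
  \<open>sup\<close>. In \<open>add\<close> and \<open>scale\<close> the index may change, because
  the approximants of \<open>face\<close> are not homogeneous one by one.\<close>

lemma lattice_sublinear_INF:
  fixes f :: "'i \<Rightarrow> 'a::{real_vector,lattice} \<Rightarrow> real"
  assumes ne: "I \<noteq> {}"
    and bdd: "\<And>x. bdd_below ((\<lambda>i. f i x) ` I)"
    and add: "\<And>i j. i \<in> I \<Longrightarrow> j \<in> I \<Longrightarrow> \<exists>k\<in>I. \<forall>x y. f k (x + y) \<le> f i x + f j y"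
    and scale: "\<And>i c. i \<in> I \<Longrightarrow> c > 0 \<Longrightarrow> \<exists>j\<in>I. \<forall>x. f j (c *\<^sub>R x) \<le> c * f i x"
    and sup: "\<And>i x y. i \<in> I \<Longrightarrow> f i (sup x y) = max (f i x) (f i y)"
    and directed: "\<And>i j. i \<in> I \<Longrightarrow> j \<in> I \<Longrightarrow> \<exists>k\<in>I. \<forall>x. f k x \<le> f i x \<and> f k x \<le> f j x"
  shows "lattice_sublinear (\<lambda>x. INF i\<in>I. f i x)"
proof -
  define p where "p x = (INF i\<in>I. f i x)" for x
  have lower: "p x \<le> f k x" if "k \<in> I" for k x
    unfolding p_def by (rule cINF_lower[OF bdd that])
  have near: "\<exists>k\<in>I. f k x < r" if "p x < r" for x r
    using that cINF_less_iff[OF ne bdd] unfolding p_def by blast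
  have "p (x + y) \<le> p x + p y" for x y
  proof (rule field_le_epsilon)
    fix e :: real assume "e > 0"
    then obtain i j where k: "i \<in> I" "j \<in> I" "f i x < p x + e/2" "f j y < p y + e/2"
      using near[of x "p x + e/2"] near[of y "p y + e/2"] by auto
    then obtain k where "k \<in> I" "f k (x + y) \<le> f i x + f j y" using add by blast
    then show "p (x + y) \<le> p x + p y + e" using lower[of k "x + y"] k by simp
  qed
  moreover
  have le: "p (c *\<^sub>R x) \<le> c * p x" if "c > 0" for c x
  proof (rule field_le_epsilon)
    fix e :: real assume "e > 0"
    then have "p x < p x + e/c" using \<open>c > 0\<close> by simp
    then obtain k where k: "k \<in> I" "f k x < p x + e/c" using near by blast
    then obtain k' where "k' \<in> I" "f k' (c *\<^sub>R x) \<le> c * f k x" using scale \<open>c > 0\<close> by blast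
    moreover have "c * f k x \<le> c * p x + e" using k(2) that by (simp add: field_simps)
    ultimately show "p (c *\<^sub>R x) \<le> c * p x + e" using lower[of k' "c *\<^sub>R x"] by simp
  qed
  have "p (c *\<^sub>R x) = c * p x" if "c > 0" for c x
    using le[OF that, of x] le[of "1/c" "c *\<^sub>R x"] that by (simp add: field_simps)
  moreover
  have "p (sup x y) = max (p x) (p y)" for x y
  proof (rule antisym)
    show "max (p x) (p y) \<le> p (sup x y)"
    proof (rule max.boundedI)
      have "f k x \<le> f k (sup x y)" "f k y \<le> f k (sup x y)" if "k \<in> I" for k using sup[OF that] by auto
      then show "p x \<le> p (sup x y)" "p y \<le> p (sup x y)"
        unfolding p_def by (blast intro: cINF_mono[OF ne bdd])+
    qed
    show "p (sup x y) \<le> max (p x) (p y)"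
    proof (rule field_le_epsilon)
      fix e :: real assume "e > 0"
      then obtain i j where k: "i \<in> I" "j \<in> I" "f i x < p x + e" "f j y < p y + e"
        using near[of x "p x + e"] near[of y "p y + e"] by auto
      then obtain k where k': "k \<in> I" "\<And>x. f k x \<le> f i x \<and> f k x \<le> f j x" using directed by blast
      have "f k x < p x + e" "f k y < p y + e"
        using k'(2)[of x] k'(2)[of y] k(3,4) by linarith+
      then have "f k (sup x y) \<le> max (p x) (p y) + e" unfolding sup[OF k'(1)] by linarith
      then show "p (sup x y) \<le> max (p x) (p y) + e" using lower[OF k'(1), of "sup x y"] by simp
    qed
  qed
  ultimately show ?thesis unfolding lattice_sublinear_def p_def by blast
qed

text \<open>If \<open>p\<close> belongs to \<open>C\<close>, then \<open>face p w\<close> belongs to the part of \<open>C\<close> on which \<open>w\<close> attains its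
  maximum \<open>p w\<close>.\<close>

definition face :: "('a::{real_vector,lattice} \<Rightarrow> real) \<Rightarrow> 'a \<Rightarrow> 'a \<Rightarrow> real" where
  "face p w x = (INF s\<in>{0..}. p (x + s *\<^sub>R w) - s * p w)"

lemma face_bdd_below:
  assumes "lattice_sublinear p"
  shows "bdd_below ((\<lambda>s. p (x + s *\<^sub>R w) - s * p w) ` {0..})"
proof (rule bdd_belowI2[of _ "- p (- x)"])
  fix s :: real assume "s \<in> {0..}"
  then have "p (s *\<^sub>R w) = s * p w"
    using lattice_sublinearD(2)[OF assms, of s w] lattice_sublinear_zero[OF assms]
    by (cases "s = 0") auto
  moreover have "p (s *\<^sub>R w) \<le> p (x + s *\<^sub>R w) + p (- x)"
    using lattice_sublinearD(1)[OF assms, of "x + s *\<^sub>R w" "- x"] by simp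
  ultimately show "- p (- x) \<le> p (x + s *\<^sub>R w) - s * p w" by simp
qed

lemma face_le:
  assumes "lattice_sublinear p" "s \<ge> 0"
  shows "face p w x \<le> p (x + s *\<^sub>R w) - s * p w"
  unfolding face_def by (rule cINF_lower[OF face_bdd_below[OF assms(1)]]) (use assms(2) in simp)

text \<open>The approximants decrease in \<open>s\<close>, so a larger parameter serves as a common
  lower bound. Adding arguments adds the parameters, scaling by \<open>c\<close> multiplies them by
  \<open>c\<close>, and \<open>sup\<close> is respected at each \<open>s\<close> because it commutes
  with translations.\<close>

lemma lattice_sublinear_face:
  fixes p :: "'a::{ordered_real_vector,lattice_ab_group_add} \<Rightarrow> real"
  assumes p: "lattice_sublinear p"
  shows "lattice_sublinear (face p w)"
proof -
  let ?q = "\<lambda>s x. p (x + s *\<^sub>R w) - s * p w"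
  have hom: "p (s *\<^sub>R w) = s * p w" if "s \<ge> 0" for s
    using lattice_sublinearD(2)[OF p, of s w] lattice_sublinear_zero[OF p] that
    by (cases "s = 0") auto
  have antimono: "?q s' x \<le> ?q s x" if "0 \<le> s" "s \<le> s'" for s s' x
  proof -
    have "p ((x + s *\<^sub>R w) + (s' - s) *\<^sub>R w) \<le> p (x + s *\<^sub>R w) + (s' - s) * p w"
      using lattice_sublinearD(1)[OF p, of "x + s *\<^sub>R w" "(s' - s) *\<^sub>R w"] hom[of "s' - s"] that by simp
    moreover have "(x + s *\<^sub>R w) + (s' - s) *\<^sub>R w = x + s' *\<^sub>R w" by (simp add: algebra_simps)
    ultimately show ?thesis by (simp add: algebra_simps)
  qed
  have "lattice_sublinear (\<lambda>x. INF s\<in>{0..}. ?q s x)"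
  proof (rule lattice_sublinear_INF)
    show "{0::real..} \<noteq> {}" by auto
    show "bdd_below ((\<lambda>s. ?q s x) ` {0..})" for x by (rule face_bdd_below[OF p])
  next
    fix s1 s2 :: real assume s: "s1 \<in> {0..}" "s2 \<in> {0..}"
    have "p (x + y + (s1 + s2) *\<^sub>R w) \<le> p (x + s1 *\<^sub>R w) + p (y + s2 *\<^sub>R w)" for x y
      using lattice_sublinearD(1)[OF p, of "x + s1 *\<^sub>R w" "y + s2 *\<^sub>R w"] by (simp add: algebra_simps)
    then have "?q (s1 + s2) (x + y) \<le> ?q s1 x + ?q s2 y" for x y by (simp add: algebra_simps)
    then show "\<exists>s\<in>{0..}. \<forall>x y. ?q s (x + y) \<le> ?q s1 x + ?q s2 y"
      using s by (intro bexI[of _ "s1 + s2"]) auto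
    show "\<exists>s\<in>{0..}. \<forall>x. ?q s x \<le> ?q s1 x \<and> ?q s x \<le> ?q s2 x"
      using antimono[of s1 "max s1 s2"] antimono[of s2 "max s1 s2"] s
      by (intro bexI[of _ "max s1 s2"]) auto
  next
    fix s c :: real assume s: "s \<in> {0..}" and "c > 0"
    have "p (c *\<^sub>R x + (c * s) *\<^sub>R w) = c * p (x + s *\<^sub>R w)" for x
      using lattice_sublinearD(2)[OF p \<open>c > 0\<close>, of "x + s *\<^sub>R w"] by (simp add: scaleR_add_right)
    then have "?q (c * s) (c *\<^sub>R x) \<le> c * ?q s x" for x by (simp add: algebra_simps)
    then show "\<exists>s'\<in>{0..}. \<forall>x. ?q s' (c *\<^sub>R x) \<le> c * ?q s x"
      using s \<open>c > 0\<close> by (intro bexI[of _ "c * s"]) auto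
  next
    fix s x y
    show "?q s (sup x y) = max (?q s x) (?q s y)"
      by (auto simp: add_sup_distrib_right lattice_sublinearD(3)[OF p])
  qed
  then show ?thesis by (simp add: lattice_sublinear_def face_def)
qed

text \<open>A minimal \<open>h\<close> below \<open>p\<close> exists by Zorn. Its face at any
  \<open>x\<close> lies below \<open>h\<close>, hence equals \<open>h\<close>, and evaluating that
  face at \<open>- x\<close> gives \<open>h (- x) \<le> - h x\<close>. An odd sublinear functional
  is additive, so \<open>h\<close> is a Riesz homomorphism.\<close>

lemma lattice_sublinear_dominates_odd:
  fixes p :: "'a::{ordered_real_vector,lattice_ab_group_add} \<Rightarrow> real"
  assumes p: "lattice_sublinear p"
  obtains h where "lattice_sublinear h" "h \<le> p" "\<And>x. h (- x) = - h x"
proof -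
  let ?A = "{q. lattice_sublinear q \<and> q \<le> p}"
  have "\<exists>m\<in>?A. \<forall>a\<in>?A. a \<le> m \<longrightarrow> a = m"
  proof (rule predicate_Zorn)
    \<comment> \<open>The order is reversed, so that a maximal element is a minimal functional;
      chains are bounded by their pointwise infima.\<close>
    show "partial_order_on ?A (relation_of (\<lambda>x y. y \<le> x) ?A)"
      unfolding partial_order_on_def preorder_on_def refl_on_def trans_def antisym_def relation_of_def
      by (auto intro: order_trans antisym)
  next
    fix C assume C: "C \<in> Chains (relation_of (\<lambda>x y. y \<le> x) ?A)"
    then have CA: "C \<subseteq> ?A" and chain: "\<And>a b. a \<in> C \<Longrightarrow> b \<in> C \<Longrightarrow> a \<le> b \<or> b \<le> a"
      unfolding Chains_def relation_of_def by auto
    show "\<exists>q\<in>?A. \<forall>a\<in>C. q \<le> a"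
    proof (cases "C = {}")
      case True
      then show ?thesis using p by blast
    next
      case False
      define q where "q x = (INF a\<in>C. a x)" for x
      have bdd: "bdd_below ((\<lambda>a. a x) ` C)" for x
      proof (rule bdd_belowI[of _ "- p (- x)"], clarsimp)
        fix a assume "a \<in> C"
        then have "lattice_sublinear a" "a (- x) \<le> p (- x)" using CA by (auto simp: le_fun_def)
        then show "- p (- x) \<le> a x" using lattice_sublinear_minus[of a x] by simp
      qed
      have "lattice_sublinear q" unfolding q_def
      proof (rule lattice_sublinear_INF[OF False bdd])
        fix a b assume ab: "a \<in> C" "b \<in> C"
        then obtain c where c: "c \<in> C" "c \<le> a" "c \<le> b" using chain by blast
        then show "\<exists>c\<in>C. \<forall>x. c x \<le> a x \<and> c x \<le> b x" by (auto simp: le_fun_def)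
        have "c (x + y) \<le> a x + b y" for x y
          using lattice_sublinearD(1)[of c x y] CA c(1) c(2,3)[THEN le_funD, of x]
            c(2,3)[THEN le_funD, of y] by fastforce
        with c(1) show "\<exists>q\<in>C. \<forall>x y. q (x + y) \<le> a x + b y" by blast
      next
        fix a and c :: real assume "a \<in> C" "c > 0"
        then show "\<exists>q\<in>C. \<forall>x. q (c *\<^sub>R x) \<le> c * a x"
          using CA lattice_sublinearD(2)[of a c] by (intro bexI[of _ a]) auto
      next
        fix a x y assume "a \<in> C"
        then show "a (sup x y) = max (a x) (a y)" using CA lattice_sublinearD(3)[of a] by blast
      qed
      moreover have le: "q \<le> a" if "a \<in> C" for a
        unfolding q_def by (rule le_funI) (rule cINF_lower[OF bdd that])
      moreover have "q \<le> p" using le False CA by (metis (no_types, lifting) CollectD ex_in_conv order_trans subsetD)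
      ultimately show ?thesis by blast
    qed
  qed
  then obtain h where h: "lattice_sublinear h" "h \<le> p"
    and minimal: "\<And>a. lattice_sublinear a \<Longrightarrow> a \<le> h \<Longrightarrow> a = h"
    by (auto intro: order_trans)
  have "h (- x) = - h x" for x
  proof -
    have "face h x \<le> h" using face_le[OF h(1), of 0 x] by (auto simp: le_fun_def)
    then have "face h x = h" by (rule minimal[OF lattice_sublinear_face[OF h(1)]])
    then have "h (- x) \<le> - h x"
      using face_le[OF h(1), of 1 x "- x"] lattice_sublinear_zero[OF h(1)] by simp
    moreover have "- h x \<le> h (- x)" using lattice_sublinear_minus[OF h(1), of "- x"] by simp
    ultimately show ?thesis by simp
  qed
  then show ?thesis using that h by blast
qed

section \<open>Uniform approximation by lattices of continuous functions\<close>

text \<open>The sets on which some \<open>ev x\<close> exceeds \<open>f\<close> are open because the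
  inequality is strict. Finitely many of them cover \<open>K\<close>, and directedness replaces the
  finitely many members by one.\<close>

lemma compact_directed_dominates:
  fixes ev :: "'i \<Rightarrow> 'k \<Rightarrow> real"
  assumes K: "compact_space K" and "A \<noteq> {}"
    and cont: "\<And>x. x \<in> A \<Longrightarrow> continuous_map K euclideanreal (ev x)" "continuous_map K euclideanreal f"
    and directed: "\<And>x y. x \<in> A \<Longrightarrow> y \<in> A \<Longrightarrow>
      \<exists>z\<in>A. \<forall>k\<in>topspace K. max (ev x k) (ev y k) \<le> ev z k"
    and local: "\<And>k. k \<in> topspace K \<Longrightarrow> \<exists>x\<in>A. f k < ev x k"
  shows "\<exists>x\<in>A. \<forall>k\<in>topspace K. f k < ev x k"
proof -
  define U where "U x = {k \<in> topspace K. ev x k - f k \<in> {0<..}}" for x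
  have "openin K (U x)" if "x \<in> A" for x
    unfolding U_def
    by (rule openin_continuous_map_preimage[of K euclideanreal])
       (use cont(1)[OF that] cont(2) in \<open>auto intro: continuous_map_diff\<close>)
  moreover have "topspace K \<subseteq> \<Union>(U ` A)" using local by (fastforce simp: U_def)
  ultimately obtain F where F: "finite F" "F \<subseteq> U ` A" "topspace K \<subseteq> \<Union>F"
    using K[unfolded compact_space_alt, rule_format, of "U ` A"] by blast
  then obtain B where B: "finite B" "B \<subseteq> A" "F = U ` B" by (meson finite_subset_image)
  have "\<exists>z\<in>A. \<forall>x\<in>B. \<forall>k\<in>topspace K. ev x k \<le> ev z k"
    using B(1,2)
  proof (induction B)
    case empty
    then show ?case using \<open>A \<noteq> {}\<close> by blast
  next
    case (insert x B)
    then obtain z where z: "z \<in> A" "\<forall>x\<in>B. \<forall>k\<in>topspace K. ev x k \<le> ev z k" by blast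
    obtain z' where z': "z' \<in> A" "\<forall>k\<in>topspace K. max (ev x k) (ev z k) \<le> ev z' k"
      using directed[of x z] insert.prems z(1) by blast
    have "ev y k \<le> ev z' k" if "y \<in> insert x B" "k \<in> topspace K" for y k
      using z(2) z'(2)[rule_format, OF that(2)] that by force
    then show ?case using z'(1) by blast
  qed
  then obtain z where z: "z \<in> A" "\<And>x k. x \<in> B \<Longrightarrow> k \<in> topspace K \<Longrightarrow> ev x k \<le> ev z k" by blast
  have "f k < ev z k" if k: "k \<in> topspace K" for k
  proof -
    obtain x where "x \<in> B" "k \<in> U x" using F(3) B(3) k by blast
    then show ?thesis using z(2)[of x k] k by (simp add: U_def)
  qed
  with z(1) show ?thesis by blast
qed

text \<open>Kakutani-Stone form of the Stone-Weierstrass theorem, by two covering arguments. For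
  fixed \<open>l\<close>, members close to \<open>f\<close> at \<open>l\<close> are joined upwards
  until they exceed \<open>f - e\<close> everywhere; the results for varying \<open>l\<close> are
  then met downwards until they stay below \<open>f + e\<close>.\<close>

lemma lattice_uniform_approximation:
  fixes ev :: "'i \<Rightarrow> 'k \<Rightarrow> real"
  assumes K: "compact_space K" and "A \<noteq> {}"
    and cont: "\<And>x. x \<in> A \<Longrightarrow> continuous_map K euclideanreal (ev x)" "continuous_map K euclideanreal f"
    and max: "\<And>x y. x \<in> A \<Longrightarrow> y \<in> A \<Longrightarrow> \<exists>z\<in>A. \<forall>k\<in>topspace K. ev z k = max (ev x k) (ev y k)"
    and min: "\<And>x y. x \<in> A \<Longrightarrow> y \<in> A \<Longrightarrow> \<exists>z\<in>A. \<forall>k\<in>topspace K. ev z k = min (ev x k) (ev y k)"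
    and interpolate: "\<And>k l. k \<in> topspace K \<Longrightarrow> l \<in> topspace K \<Longrightarrow> \<exists>x\<in>A. ev x k = f k \<and> ev x l = f l"
    and "e > 0"
  shows "\<exists>x\<in>A. \<forall>k\<in>topspace K. \<bar>ev x k - f k\<bar> < e"
proof (cases "topspace K = {}")
  case True
  then show ?thesis using \<open>A \<noteq> {}\<close> by blast
next
  case False
  have cont_minus: "continuous_map K euclideanreal (\<lambda>k. f k - e)"
    by (intro continuous_map_diff cont(2)) auto
  have cont_neg: "continuous_map K euclideanreal (\<lambda>k. - (f k + e))"
    by (intro continuous_map_minus continuous_map_add cont(2)) auto
  define B where "B = {x \<in> A. \<forall>k\<in>topspace K. f k - e < ev x k}"
  have above: "\<exists>x\<in>B. ev x l < f l + e" if l: "l \<in> topspace K" for l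
  proof -
    let ?A = "{x \<in> A. ev x l < f l + e}"
    have "\<exists>x\<in>?A. \<forall>k\<in>topspace K. f k - e < ev x k"
    proof (rule compact_directed_dominates[OF K])
      show "?A \<noteq> {}" using interpolate[OF l l] \<open>e > 0\<close> by force
      show "continuous_map K euclideanreal (ev x)" if "x \<in> ?A" for x using cont(1) that by blast
      show "continuous_map K euclideanreal (\<lambda>k. f k - e)" by (rule cont_minus)
      show "\<exists>z\<in>?A. \<forall>k\<in>topspace K. max (ev x k) (ev y k) \<le> ev z k" if "x \<in> ?A" "y \<in> ?A" for x y
        using max[of x y] that l by fastforce
      show "\<exists>x\<in>?A. f k - e < ev x k" if "k \<in> topspace K" for k
        using interpolate[OF that l] \<open>e > 0\<close> by fastforce
    qed
    then show ?thesis by (auto simp: B_def)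
  qed
  have "\<exists>x\<in>B. \<forall>k\<in>topspace K. - (f k + e) < - ev x k"
  proof (rule compact_directed_dominates[OF K])
    show "B \<noteq> {}" using above False by blast
    show "continuous_map K euclideanreal (\<lambda>k. - ev x k)" if "x \<in> B" for x
      using cont(1) that by (auto simp: B_def intro: continuous_map_minus)
    show "continuous_map K euclideanreal (\<lambda>k. - (f k + e))" by (rule cont_neg)
    show "\<exists>z\<in>B. \<forall>k\<in>topspace K. max (- ev x k) (- ev y k) \<le> - ev z k" if B: "x \<in> B" "y \<in> B" for x y
    proof -
      obtain z where "z \<in> A" "\<forall>k\<in>topspace K. ev z k = min (ev x k) (ev y k)"
        using min[of x y] B unfolding B_def by blast
      then show ?thesis using B by (intro bexI[of _ z]) (auto simp: B_def)
    qed
    show "\<exists>x\<in>B. - (f k + e) < - ev x k" if "k \<in> topspace K" for k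
      using above[OF that] by force
  qed
  then obtain x where x: "x \<in> B" "\<forall>k\<in>topspace K. - (f k + e) < - ev x k" by blast
  have "\<bar>ev x k - f k\<bar> < e" if "k \<in> topspace K" for k
    using x(1) bspec[OF x(2) that] that by (auto simp: B_def abs_less_iff)
  then show ?thesis using x(1) by (auto simp: B_def)
qed

section \<open>Yosida's representation theorem\<close>

text \<open>Adding \<open>x\<close> to a multiple of \<open>x\<close> gives another multiple, so the
  supremum of all multiples, which exists by Dedekind completeness, is at most itself minus
  \<open>x\<close>.\<close>

lemma riesz_archimedean:
  fixes x y :: "'a::dedekind_complete_riesz_space"
  assumes "\<And>n::nat. real n *\<^sub>R x \<le> y"
  shows "x \<le> 0"
proof -
  let ?S = "range (\<lambda>n::nat. real n *\<^sub>R x)"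
  have bdd: "bdd_above ?S" using assms by (auto intro!: bdd_aboveI[of _ y])
  have "Sup ?S \<le> Sup ?S - x"
  proof (rule cSup_least)
    fix z assume "z \<in> ?S"
    then obtain n :: nat where n: "z = real n *\<^sub>R x" by blast
    have "real (Suc n) *\<^sub>R x \<le> Sup ?S" by (rule cSup_upper[OF _ bdd]) blast
    moreover have "real (Suc n) *\<^sub>R x = z + x" by (simp add: n scaleR_left_distrib)
    ultimately show "z \<le> Sup ?S - x" by (simp add: le_diff_eq)
  qed auto
  then show ?thesis by simp
qed

lemma strong_order_unit_bound:
  assumes "strong_order_unit u"
  obtains b where "x \<le> b *\<^sub>R u" "- x \<le> b *\<^sub>R u" "b \<ge> 0"
proof -
  obtain b where b: "\<bar>x\<bar> \<le> b *\<^sub>R u" using assms by (auto simp: strong_order_unit_def)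
  have "b *\<^sub>R u \<le> max b 0 *\<^sub>R u"
    using assms by (intro scaleR_right_mono) (auto simp: strong_order_unit_def)
  then have "\<bar>x\<bar> \<le> max b 0 *\<^sub>R u" using b by order
  then show ?thesis using that[of "max b 0"] by (simp add: abs_lattice)
qed

text \<open>On C(K) this is the maximum of \<open>x\<close> over \<open>K\<close>, the functional
  that belongs to the whole spectrum. Unlike \<open>gauge_norm\<close> it is one-sided and can be
  negative.\<close>

definition upper_gauge :: "'a::dedekind_complete_riesz_space \<Rightarrow> 'a \<Rightarrow> real" where
  "upper_gauge u x = Inf {b. x \<le> b *\<^sub>R u}"

context
  fixes u :: "'a::dedekind_complete_riesz_space"
  assumes u: "strong_order_unit u" and nz: "u \<noteq> 0"
begin

lemma upper_gauge_bdd: "bdd_below {b. x \<le> b *\<^sub>R u}"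
proof -
  obtain M where M: "- x \<le> M *\<^sub>R u" using strong_order_unit_bound[OF u] by metis
  have "- M \<le> b" if "x \<le> b *\<^sub>R u" for b
  proof (rule ccontr)
    assume "\<not> - M \<le> b"
    then have "(b + M) *\<^sub>R u \<le> 0"
      using u by (intro scaleR_nonpos_nonneg) (auto simp: strong_order_unit_def)
    moreover have "0 \<le> (b + M) *\<^sub>R u" using add_mono[OF that M] by (simp add: scaleR_left_distrib)
    ultimately show False using \<open>\<not> - M \<le> b\<close> nz by auto
  qed
  then show ?thesis by (intro bdd_belowI[of _ "- M"]) auto
qed

lemma upper_gauge_le: "x \<le> b *\<^sub>R u \<Longrightarrow> upper_gauge u x \<le> b"
  unfolding upper_gauge_def by (rule cInf_lower[OF _ upper_gauge_bdd]) simp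

lemma le_upper_gauge: "upper_gauge u x < b \<Longrightarrow> x \<le> b *\<^sub>R u"
proof -
  assume "upper_gauge u x < b"
  moreover have "{b. x \<le> b *\<^sub>R u} \<noteq> {}" using strong_order_unit_bound[OF u, of x] by blast
  ultimately obtain c where "x \<le> c *\<^sub>R u" "c < b"
    unfolding upper_gauge_def by (metis (no_types, lifting) cInf_lessD mem_Collect_eq)
  moreover have "c *\<^sub>R u \<le> b *\<^sub>R u"
    using u \<open>c < b\<close> by (intro scaleR_right_mono) (auto simp: strong_order_unit_def)
  ultimately show ?thesis by order
qed

lemma lattice_sublinear_upper_gauge: "lattice_sublinear (upper_gauge u)"
  unfolding lattice_sublinear_def
proof (intro conjI allI impI)
  fix x y
  show "upper_gauge u (x + y) \<le> upper_gauge u x + upper_gauge u y"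
  proof (rule field_le_epsilon)
    fix e :: real assume "e > 0"
    then have "x \<le> (upper_gauge u x + e/2) *\<^sub>R u" "y \<le> (upper_gauge u y + e/2) *\<^sub>R u"
      by (intro le_upper_gauge; simp)+
    from add_mono[OF this] have "x + y \<le> (upper_gauge u x + e/2 + (upper_gauge u y + e/2)) *\<^sub>R u"
      by (simp only: scaleR_left_distrib)
    from upper_gauge_le[OF this] show "upper_gauge u (x + y) \<le> upper_gauge u x + upper_gauge u y + e"
      by simp
  qed
  show "upper_gauge u (sup x y) = max (upper_gauge u x) (upper_gauge u y)"
  proof (rule antisym)
    show "upper_gauge u (sup x y) \<le> max (upper_gauge u x) (upper_gauge u y)"
    proof (rule field_le_epsilon)
      fix e :: real assume "e > 0"
      then show "upper_gauge u (sup x y) \<le> max (upper_gauge u x) (upper_gauge u y) + e"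
        by (intro upper_gauge_le sup_least le_upper_gauge) auto
    qed
    have "upper_gauge u z \<le> upper_gauge u (sup x y)" if "z \<le> sup x y" for z
    proof (rule field_le_epsilon)
      fix e :: real assume "e > 0"
      then have "sup x y \<le> (upper_gauge u (sup x y) + e) *\<^sub>R u" by (intro le_upper_gauge) simp
      then show "upper_gauge u z \<le> upper_gauge u (sup x y) + e"
        using that by (intro upper_gauge_le) order
    qed
    then show "max (upper_gauge u x) (upper_gauge u y) \<le> upper_gauge u (sup x y)" by simp
  qed
next
  fix c :: real and x assume "c > 0"
  have le: "upper_gauge u (c *\<^sub>R x) \<le> c * upper_gauge u x" if "c > 0" for c x
  proof (rule field_le_epsilon)
    fix e :: real assume "e > 0"
    then have "x \<le> (upper_gauge u x + e / c) *\<^sub>R u" using that by (intro le_upper_gauge) simp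
    then have "c *\<^sub>R x \<le> c *\<^sub>R ((upper_gauge u x + e / c) *\<^sub>R u)"
      using that by (intro scaleR_left_mono) auto
    then show "upper_gauge u (c *\<^sub>R x) \<le> c * upper_gauge u x + e"
      using that by (intro upper_gauge_le) (simp add: distrib_left)
  qed
  show "upper_gauge u (c *\<^sub>R x) = c * upper_gauge u x"
    using le[OF \<open>c > 0\<close>, of x] le[of "1/c" "c *\<^sub>R x"] \<open>c > 0\<close> by (simp add: field_simps)
qed

end

text \<open>The points of the representing space are kept as plain functions, so that compactness
  can be taken from the product topology.\<close>

definition spectrum :: "'a::dedekind_complete_riesz_space \<Rightarrow> ('a \<Rightarrow> real) set" where
  "spectrum u = {h. (\<forall>x y. h (x + y) = h x + h y) \<and> (\<forall>c x. h (c *\<^sub>R x) = c * h x) \<and>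
     (\<forall>x y. h (sup x y) = max (h x) (h y)) \<and> (\<forall>x y. h (inf x y) = min (h x) (h y)) \<and> h u = 1}"

text \<open>Starting from the face at \<open>x\<close> instead of the full gauge forces
  \<open>h\<close> to attain the gauge at \<open>x\<close>. This value is positive, since otherwise
  all multiples of \<open>x\<close> would lie below \<open>u\<close>, against the Archimedean
  property.\<close>

lemma spectrum_separates:
  fixes u :: "'a::dedekind_complete_riesz_space"
  assumes u: "strong_order_unit u" and x: "\<not> x \<le> 0"
  obtains h where "h \<in> spectrum u" "h x > 0"
proof -
  have nz: "u \<noteq> 0"
  proof
    assume "u = 0"
    then have "x \<le> 0" using strong_order_unit_bound[OF u, of x] by auto
    then show False using x by blast
  qed
  let ?p = "upper_gauge u"
  note p = lattice_sublinear_upper_gauge[OF u nz]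
  have pos: "?p x > 0"
  proof (rule ccontr)
    assume "\<not> ?p x > 0"
    have "real n *\<^sub>R x \<le> u" for n :: nat
    proof (cases "n = 0")
      case True
      then show ?thesis using u by (simp add: strong_order_unit_def)
    next
      case False
      have "?p (real n *\<^sub>R x) < 1"
        using lattice_sublinearD(2)[OF p, of "real n" x] False \<open>\<not> ?p x > 0\<close>
        by (smt (verit) mult_pos_pos of_nat_0_less_iff not_gr_zero mult_nonneg_nonpos)
      then show ?thesis using le_upper_gauge[OF u nz, of _ 1] by simp
    qed
    then show False using riesz_archimedean x by blast
  qed
  obtain h where h: "lattice_sublinear h" "h \<le> face ?p x" "\<And>x. h (- x) = - h x"
    using lattice_sublinear_dominates_odd[OF lattice_sublinear_face[OF p, of x]] by metis
  have hp: "h y \<le> ?p y" for y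
    using h(2)[THEN le_funD, of y] face_le[OF p, of 0 x y] by simp
  have "h (- x) \<le> - ?p x"
    using h(2)[THEN le_funD, of "- x"] face_le[OF p, of 1 x "- x"] lattice_sublinear_zero[OF p] by simp
  then have hx: "h x > 0" using pos h(3) by simp
  \<comment> \<open>Oddness turns the one-sided bounds at \<open>u\<close> and \<open>- u\<close>
    into the normalization \<open>h u = 1\<close>.\<close>
  have "h u \<le> 1" using hp[of u] upper_gauge_le[OF u nz, of u 1] by simp
  moreover have "h (- u) \<le> - 1" using hp[of "- u"] upper_gauge_le[OF u nz, of "- u" "-1"] by simp
  ultimately have hu: "h u = 1" using h(3)[of u] by simp
  have add: "h (y + z) = h y + h z" for y z
    using lattice_sublinearD(1)[OF h(1), of y z] lattice_sublinearD(1)[OF h(1), of "- y" "- z"]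
      h(3)[of "y + z"] h(3)[of y] h(3)[of z] by simp
  have scale: "h (c *\<^sub>R y) = c * h y" for c y
  proof (cases c "0::real" rule: linorder_cases)
    case less
    then show ?thesis using lattice_sublinearD(2)[OF h(1), of "- c" y] h(3)[of "c *\<^sub>R y"] by simp
  qed (use lattice_sublinearD(2)[OF h(1)] lattice_sublinear_zero[OF h(1)] in auto)
  have inf: "h (inf y z) = min (h y) (h z)" for y z
    unfolding inf_eq_neg_sup h(3) lattice_sublinearD(3)[OF h(1)] by simp
  have "h \<in> spectrum u"
    using add scale inf lattice_sublinearD(3)[OF h(1)] hu by (simp add: spectrum_def)
  then show ?thesis using that hx by blast
qed

lemma le_iff_spectrum:
  assumes "strong_order_unit u"
  shows "x \<le> y \<longleftrightarrow> (\<forall>h\<in>spectrum u. h x \<le> h y)"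
proof
  assume "x \<le> y"
  show "\<forall>h\<in>spectrum u. h x \<le> h y"
  proof
    fix h assume "h \<in> spectrum u"
    then have "h (sup x y) = max (h x) (h y)" by (simp add: spectrum_def)
    then show "h x \<le> h y" using \<open>x \<le> y\<close> by (simp add: sup_absorb2)
  qed
next
  assume le: "\<forall>h\<in>spectrum u. h x \<le> h y"
  have "x - y \<le> 0"
  proof (rule ccontr)
    assume "\<not> x - y \<le> 0"
    then obtain h where h: "h \<in> spectrum u" "h (x - y) > 0" using spectrum_separates[OF assms] by blast
    have "h ((x - y) + y) = h (x - y) + h y" using h(1) unfolding spectrum_def by blast
    then show False using le h by fastforce
  qed
  then show "x \<le> y" by simp
qed

section \<open>Compactness of the spectrum and continuous functions on it\<close>

lemma closed_spectrum: "closed (spectrum u)"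
  unfolding spectrum_def
  by (intro closed_Collect_conj closed_Collect_all closed_Collect_eq continuous_on_add
    continuous_on_mult continuous_on_max continuous_on_min continuous_on_const
    continuous_on_product_coordinates)

text \<open>Tychonoff: the order unit bounds on \<open>x\<close> and \<open>- x\<close> confine
  \<open>h x\<close> to a fixed interval, and the spectrum is a closed subset of the product of
  these intervals.\<close>

lemma compact_spectrum:
  assumes u: "strong_order_unit u"
  shows "compact (spectrum u)"
proof -
  have "\<forall>x. \<exists>b. x \<le> b *\<^sub>R u \<and> - x \<le> b *\<^sub>R u" using strong_order_unit_bound[OF u] by metis
  then obtain M where M: "\<And>x. x \<le> M x *\<^sub>R u" "\<And>x. - x \<le> M x *\<^sub>R u" by metis
  have "compactin (product_topology (\<lambda>_. euclideanreal) UNIV) (PiE UNIV (\<lambda>x. {- M x..M x}))"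
    by (simp add: compactin_PiE)
  then have "compact (PiE UNIV (\<lambda>x. {- M x..M x}))" by (simp add: euclidean_product_topology)
  moreover have "spectrum u \<subseteq> PiE UNIV (\<lambda>x. {- M x..M x})"
  proof
    fix h assume h: "h \<in> spectrum u"
    have "h x \<in> {- M x..M x}" for x
    proof -
      have scale: "h (c *\<^sub>R y) = c * h y" "h u = 1" for c y using h by (simp_all add: spectrum_def)
      have "h x \<le> h (M x *\<^sub>R u)" "h (- x) \<le> h (M x *\<^sub>R u)"
        using M le_iff_spectrum[OF u] h by blast+
      then show ?thesis using scale(1)[of "-1" x] scale by simp
    qed
    then show "h \<in> PiE UNIV (\<lambda>x. {- M x..M x})" by auto
  qed
  ultimately show ?thesis
    using compact_Int_closed[OF _ closed_spectrum, of "PiE UNIV (\<lambda>x. {- M x..M x})" u]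
    by (simp add: Int_absorb1)
qed

lemma continuous_on_spectrum_eval: "continuous_on S (\<lambda>h::'a \<Rightarrow> real. h x)"
  by (rule continuous_on_subset[OF continuous_on_product_coordinates]) simp

lemma spectrum_interpolates:
  assumes "h \<in> spectrum u" "h' \<in> spectrum u" "h = h' \<longrightarrow> a = b"
  obtains x where "h x = a" "h' x = b"
proof (cases "h = h'")
  case True
  have "h (a *\<^sub>R u) = a" using assms(1) by (simp add: spectrum_def)
  then show ?thesis using True assms(3) that[of "a *\<^sub>R u"] by simp
next
  case False
  then obtain y where y: "h y \<noteq> h' y" by blast
  \<comment> \<open>\<open>c\<close> gives the two values the right difference; the multiple of
    \<open>u\<close> then shifts both equally, since both functionals are 1 at
    \<open>u\<close>.\<close>
  define c where "c = (a - b) / (h y - h' y)"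
  have "h (c *\<^sub>R y + (a - c * h y) *\<^sub>R u) = c * h y + (a - c * h y)"
    "h' (c *\<^sub>R y + (a - c * h y) *\<^sub>R u) = c * h' y + (a - c * h y)"
    using assms(1,2) by (simp_all add: spectrum_def)
  moreover have "c * (h y - h' y) = a - b" using y by (simp add: c_def)
  ultimately show ?thesis
    using that[of "c *\<^sub>R y + (a - c * h y) *\<^sub>R u"] by (simp add: algebra_simps)
qed

text \<open>Evaluation at a point need not commute with suprema, so \<open>Sup S\<close> is trapped
  uniformly: if \<open>y\<close> in \<open>S\<close> satisfies \<open>f < y + e\<close> on the
  spectrum, then \<open>y + e *\<^sub>R u\<close> is an upper bound of \<open>S\<close>.\<close>

lemma spectrum_eval_surj:
  fixes u :: "'a::dedekind_complete_riesz_space"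
  assumes u: "strong_order_unit u" and f: "continuous_on (spectrum u) f"
  obtains x where "\<And>h. h \<in> spectrum u \<Longrightarrow> h x = f h"
proof -
  let ?K = "top_of_set (spectrum u)"
  have K: "compact_space ?K" using compact_spectrum[OF u] by (simp add: compact_space_subtopology)
  have approx: "\<exists>x. \<forall>h\<in>spectrum u. \<bar>h x - g h\<bar> < e" if "e > 0" "continuous_on (spectrum u) g" for e g
  proof -
    have "\<exists>x\<in>UNIV. \<forall>h\<in>topspace ?K. \<bar>h x - g h\<bar> < e"
    proof (rule lattice_uniform_approximation[OF K])
      show "continuous_map ?K euclideanreal (\<lambda>h. h x)" for x
        by (simp add: continuous_on_spectrum_eval)
      show "continuous_map ?K euclideanreal g" using that(2) by simp
      show "\<exists>z\<in>UNIV. \<forall>h\<in>topspace ?K. h z = max (h x) (h y)" for x y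
        by (rule bexI[of _ "sup x y"]) (auto simp: spectrum_def)
      show "\<exists>z\<in>UNIV. \<forall>h\<in>topspace ?K. h z = min (h x) (h y)" for x y
        by (rule bexI[of _ "inf x y"]) (auto simp: spectrum_def)
      show "\<exists>x\<in>UNIV. h x = g h \<and> h' x = g h'" if "h \<in> topspace ?K" "h' \<in> topspace ?K" for h h'
        using spectrum_interpolates[of h u h' "g h" "g h'"] that by auto
    qed (use that in auto)
    then show ?thesis by simp
  qed
  have hom: "h (y + c *\<^sub>R u) = h y + c" if "h \<in> spectrum u" for h y c
    using that by (simp add: spectrum_def)
  define S where "S = {y. \<forall>h\<in>spectrum u. h y \<le> f h}"
  have near: "\<exists>y\<in>S. \<forall>h\<in>spectrum u. f h < h y + 2 * e" if "e > 0" for e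
  proof -
    \<comment> \<open>Aiming at \<open>f - e\<close> with error \<open>e\<close> keeps the
      approximant below \<open>f\<close>, at a loss of less than \<open>2 * e\<close>.\<close>
    have "continuous_on (spectrum u) (\<lambda>h. f h - e)" by (intro continuous_intros f)
    from approx[OF that this] obtain y where y: "\<And>h. h \<in> spectrum u \<Longrightarrow> \<bar>h y - (f h - e)\<bar> < e" by blast
    have "h y \<le> f h \<and> f h < h y + 2 * e" if "h \<in> spectrum u" for h
      using y[OF that] by linarith
    then show ?thesis unfolding S_def by blast
  qed
  have upper: "z \<le> y + (2 * e) *\<^sub>R u"
    if "\<forall>h\<in>spectrum u. f h < h y + 2 * e" "z \<in> S" for y z e
    unfolding le_iff_spectrum[OF u] using that hom[of _ y "2 * e"] by (force simp: S_def)
  obtain y0 where y0: "y0 \<in> S" "\<forall>h\<in>spectrum u. f h < h y0 + 2 * 1" using near[of 1] by auto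
  have bdd: "bdd_above S" using upper[OF y0(2)] by (intro bdd_aboveI)
  have "h (Sup S) = f h" if h: "h \<in> spectrum u" for h
  proof (rule antisym)
    show "h (Sup S) \<le> f h"
    proof (rule field_le_epsilon)
      fix e :: real assume "e > 0"
      then obtain y where y: "y \<in> S" "\<forall>h\<in>spectrum u. f h < h y + 2 * (e / 2)" using near[of "e/2"] by auto
      have "Sup S \<le> y + (2 * (e / 2)) *\<^sub>R u" using upper[OF y(2)] y0(1) by (intro cSup_least) auto
      then have "h (Sup S) \<le> h y + e" using h hom[OF h, of y e] by (force simp: le_iff_spectrum[OF u])
      moreover have "h y \<le> f h" using y(1) h by (simp add: S_def)
      ultimately show "h (Sup S) \<le> f h + e" by simp
    qed
    show "f h \<le> h (Sup S)"
    proof (rule field_le_epsilon)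
      fix e :: real assume "e > 0"
      then obtain y where y: "y \<in> S" "\<forall>h\<in>spectrum u. f h < h y + 2 * (e / 2)" using near[of "e/2"] by auto
      have "h y \<le> h (Sup S)" using cSup_upper[OF y(1) bdd] h by (simp add: le_iff_spectrum[OF u])
      then show "f h \<le> h (Sup S) + e" using y(2) h by force
    qed
  qed
  then show ?thesis using that by blast
qed

lemma yosida_representation_spectrum:
  assumes u: "strong_order_unit u"
  shows "yosida_representation u (top_of_set (spectrum u)) (\<lambda>x. restrict (\<lambda>h. h x) (spectrum u))"
proof -
  let ?\<phi> = "\<lambda>x. restrict (\<lambda>h. h x) (spectrum u)"
  have "bij_betw ?\<phi> UNIV (continuous_functions (top_of_set (spectrum u)))"
  proof (rule bij_betw_imageI)
    show "inj ?\<phi>"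
    proof (rule injI)
      fix x y assume "?\<phi> x = ?\<phi> y"
      then have "\<forall>h\<in>spectrum u. h x = h y" by (metis restrict_apply')
      then have "x \<le> y \<and> y \<le> x" unfolding le_iff_spectrum[OF u] by auto
      then show "x = y" by (blast intro: antisym)
    qed
    show "range ?\<phi> = continuous_functions (top_of_set (spectrum u))"
    proof (intro set_eqI iffI)
      fix f assume "f \<in> range ?\<phi>"
      then obtain x where x: "f = ?\<phi> x" by blast
      have "continuous_on (spectrum u) f"
        using continuous_on_spectrum_eval[of "spectrum u" x] unfolding x
        by (simp cong: continuous_on_cong)
      then show "f \<in> continuous_functions (top_of_set (spectrum u))"
        by (simp add: continuous_functions_def x)
    next
      fix f assume f: "f \<in> continuous_functions (top_of_set (spectrum u))"
      then have "continuous_on (spectrum u) f" by (simp add: continuous_functions_def)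
      from spectrum_eval_surj[OF u this] obtain x where x: "\<And>h. h \<in> spectrum u \<Longrightarrow> h x = f h" by metis
      have "f = ?\<phi> x"
        by (rule extensionalityI[of _ "spectrum u"]) (use f x in \<open>auto simp: continuous_functions_def\<close>)
      then show "f \<in> range ?\<phi>" by blast
    qed
  qed
  moreover have "Hausdorff_space (top_of_set (spectrum u))"
  proof (rule Hausdorff_space_subtopology)
    have "Hausdorff_space (product_topology (\<lambda>_::'a. euclideanreal) UNIV)"
      by (simp add: Hausdorff_space_product_topology)
    then show "Hausdorff_space (euclidean :: ('a \<Rightarrow> real) topology)"
      by (simp add: euclidean_product_topology)
  qed
  moreover have "compact_space (top_of_set (spectrum u))"
    using compact_spectrum[OF u] by (simp add: compact_space_subtopology)
  ultimately show ?thesis unfolding yosida_representation_def by (simp add: spectrum_def)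
qed

text \<open>From here on the chosen representation is accessed only through the properties in
  \<open>yosida_representation\<close>, so it does not matter which one \<open>SOME\<close>
  picks.\<close>

lemma yosida_representation_yosida:
  fixes u :: "'a::dedekind_complete_riesz_space"
  assumes "strong_order_unit u"
  shows "yosida_representation u (yosida_space u) (yosida_map u)"
proof -
  have "\<exists>z. case z of (K, \<phi>) \<Rightarrow> yosida_representation u K (\<phi> :: 'a \<Rightarrow> ('a \<Rightarrow> real) \<Rightarrow> real)" 
    using yosida_representation_spectrum[OF assms] by auto
  then have "case yosida u of (K, \<phi>) \<Rightarrow> yosida_representation u K \<phi>" unfolding yosida_def by (rule someI_ex)
  then show ?thesis by (simp add: yosida_space_def yosida_map_def case_prod_beta)
qed

section \<open>Pointwise calculus\<close>

locale order_unit_space =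
  fixes u :: "'a::dedekind_complete_riesz_space"
  assumes unit: "strong_order_unit u"
begin

abbreviation K :: "('a \<Rightarrow> real) set" where "K \<equiv> topspace (yosida_space u)"
abbreviation \<phi> :: "'a \<Rightarrow> ('a \<Rightarrow> real) \<Rightarrow> real" where "\<phi> \<equiv> yosida_map u"

lemma yosida_rep: "yosida_representation u (yosida_space u) \<phi>"
  by (rule yosida_representation_yosida[OF unit])

lemma compact_K: "compact_space (yosida_space u)"
  using yosida_rep by (simp add: yosida_representation_def)

lemma yosida_bij: "bij_betw \<phi> UNIV (continuous_functions (yosida_space u))"
  using yosida_rep by (simp add: yosida_representation_def)

lemma yosida_map_simps [simp]:
  assumes "k \<in> K"
  shows "\<phi> (x + y) k = \<phi> x k + \<phi> y k" "\<phi> (c *\<^sub>R x) k = c * \<phi> x k"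
    "\<phi> (sup x y) k = max (\<phi> x k) (\<phi> y k)" "\<phi> (inf x y) k = min (\<phi> x k) (\<phi> y k)"
    "\<phi> u k = 1"
  using yosida_rep assms unfolding yosida_representation_def by blast+

lemma yosida_map_zero [simp]: "k \<in> K \<Longrightarrow> \<phi> 0 k = 0"
  using yosida_map_simps(2)[of k 0 0] by simp

lemma yosida_map_minus [simp]: "k \<in> K \<Longrightarrow> \<phi> (- x) k = - \<phi> x k"
  using yosida_map_simps(2)[of k "-1" x] by simp

lemma yosida_map_diff [simp]: "k \<in> K \<Longrightarrow> \<phi> (x - y) k = \<phi> x k - \<phi> y k"
  using yosida_map_simps(1)[of k x "- y"] by simp

lemma yosida_map_abs [simp]: "k \<in> K \<Longrightarrow> \<phi> \<bar>x\<bar> k = \<bar>\<phi> x k\<bar>"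
  by (simp add: abs_lattice[of x] abs_real_def max_def)

lemma continuous_yosida_map: "continuous_map (yosida_space u) euclideanreal (\<phi> x)"
  using bij_betw_apply[OF yosida_bij, of x] by (simp add: continuous_functions_def)

lemma yosida_map_eqI:
  assumes "\<And>k. k \<in> K \<Longrightarrow> \<phi> x k = \<phi> y k"
  shows "x = y"
proof -
  have "\<phi> x \<in> extensional K" "\<phi> y \<in> extensional K"
    using bij_betw_apply[OF yosida_bij] by (auto simp: continuous_functions_def)
  then have "\<phi> x = \<phi> y" using assms by (rule extensionalityI)
  then show ?thesis using yosida_bij by (auto simp: bij_betw_def inj_on_def)
qed

lemma yosida_map_eq_iff: "x = y \<longleftrightarrow> (\<forall>k\<in>K. \<phi> x k = \<phi> y k)"
  by (auto intro: yosida_map_eqI)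

lemma yosida_map_le_iff: "x \<le> y \<longleftrightarrow> (\<forall>k\<in>K. \<phi> x k \<le> \<phi> y k)"
proof -
  have "x \<le> y \<longleftrightarrow> inf x y = x" by (rule le_iff_inf)
  also have "\<dots> \<longleftrightarrow> (\<forall>k\<in>K. \<phi> (inf x y) k = \<phi> x k)" by (rule yosida_map_eq_iff)
  also have "\<dots> \<longleftrightarrow> (\<forall>k\<in>K. \<phi> x k \<le> \<phi> y k)" by (auto simp: min_def)
  finally show ?thesis .
qed

lemma yosida_map_mono: "x \<le> y \<Longrightarrow> k \<in> K \<Longrightarrow> \<phi> x k \<le> \<phi> y k"
  by (simp add: yosida_map_le_iff)

lemma yosida_map_inv:
  assumes "continuous_map (yosida_space u) euclideanreal f" "k \<in> K"
  shows "\<phi> (yosida_inv u f) k = f k"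
proof -
  have "continuous_map (yosida_space u) euclideanreal (restrict f K)"
    using assms(1) by (rule continuous_map_eq) simp
  then have "restrict f K \<in> range \<phi>"
    using yosida_bij by (simp add: bij_betw_def continuous_functions_def)
  then have "\<phi> (yosida_inv u f) = restrict f K" unfolding yosida_inv_def by (rule f_inv_into_f)
  then show ?thesis using assms(2) by simp
qed

lemma yosida_map_mult [simp]: "k \<in> K \<Longrightarrow> \<phi> (riesz_mult u x y) k = \<phi> x k * \<phi> y k"
  unfolding riesz_mult_def
  by (rule yosida_map_inv) (intro continuous_map_real_mult continuous_yosida_map)

lemma yosida_map_exp [simp]: "k \<in> K \<Longrightarrow> \<phi> (riesz_exp u x) k = exp (\<phi> x k)"
  unfolding riesz_exp_def
proof (rule yosida_map_inv)
  have "continuous_map euclideanreal euclideanreal (exp :: real \<Rightarrow> real)"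
    by (simp add: continuous_on_exp)
  from continuous_map_compose[OF continuous_yosida_map this]
  show "continuous_map (yosida_space u) euclideanreal (\<lambda>k. exp (\<phi> x k))" by (simp add: o_def)
qed

text \<open>Positivity on all of \<open>K\<close>, not only at \<open>k\<close>, makes the logarithm
  continuous and so a member of C(K) with a genuine preimage.\<close>

lemma yosida_map_log:
  assumes "\<And>k. k \<in> K \<Longrightarrow> 0 < \<phi> x k" "k \<in> K"
  shows "\<phi> (riesz_log u x) k = ln (\<phi> x k)"
  unfolding riesz_log_def
proof (rule yosida_map_inv[OF _ assms(2)])
  have "continuous_map (yosida_space u) (top_of_set {0<..}) (\<phi> x)"
    using continuous_yosida_map assms(1) by (intro continuous_map_into_subtopology) auto
  moreover have "continuous_map (top_of_set {0<..}) euclideanreal (ln :: real \<Rightarrow> real)"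
    by (auto intro!: continuous_intros)
  ultimately have "continuous_map (yosida_space u) euclideanreal (ln \<circ> \<phi> x)"
    by (rule continuous_map_compose)
  then show "continuous_map (yosida_space u) euclideanreal (\<lambda>k. ln (\<phi> x k))" by (simp add: o_def)
qed

lemma yosida_map_bounded:
  obtains b where "b \<ge> 0" "\<And>k. k \<in> K \<Longrightarrow> \<bar>\<phi> x k\<bar> \<le> b"
proof -
  obtain b where b: "x \<le> b *\<^sub>R u" "- x \<le> b *\<^sub>R u" "b \<ge> 0" using strong_order_unit_bound[OF unit] .
  have "\<bar>\<phi> x k\<bar> \<le> b" if "k \<in> K" for k
    using yosida_map_mono[OF b(1) that] yosida_map_mono[OF b(2) that] that by simp
  then show ?thesis using that b(3) by blast
qed

lemma yosida_map_le_gauge_norm: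
  assumes k: "k \<in> K"
  shows "\<bar>\<phi> x k\<bar> \<le> gauge_norm u x"
  unfolding gauge_norm_def
proof (rule cInf_greatest)
  show "{\<beta>. \<bar>x\<bar> \<le> \<beta> *\<^sub>R u} \<noteq> {}" using unit by (auto simp: strong_order_unit_def)
  fix b assume "b \<in> {\<beta>. \<bar>x\<bar> \<le> \<beta> *\<^sub>R u}"
  then show "\<bar>\<phi> x k\<bar> \<le> b" using yosida_map_mono[OF _ k, of "\<bar>x\<bar>" "b *\<^sub>R u"] k by simp
qed

text \<open>Suprema are not computed pointwise on \<open>K\<close>; this is the substitute.
  Subtracting the excess \<open>d\<close> of the left side over \<open>z\<close> from
  \<open>Sup S\<close> still leaves an upper bound of \<open>S\<close>, which forces
  \<open>d \<le> 0\<close>.\<close>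

lemma inf_cSup_le:
  fixes S :: "'a set"
  assumes "S \<noteq> {}" "bdd_above S" "\<And>a. a \<in> S \<Longrightarrow> inf a c \<le> z"
  shows "inf (Sup S) c \<le> z"
proof -
  define d where "d = inf (Sup S) c - z"
  have "Sup S \<le> Sup S - d"
  proof (rule cSup_least[OF assms(1)])
    fix a assume a: "a \<in> S"
    show "a \<le> Sup S - d"
      unfolding yosida_map_le_iff
    proof
      fix k assume k: "k \<in> K"
      have "min (\<phi> a k) (\<phi> c k) \<le> \<phi> z k" "\<phi> a k \<le> \<phi> (Sup S) k"
        using yosida_map_mono[OF assms(3)[OF a] k] yosida_map_mono[OF cSup_upper[OF a assms(2)] k] k
        by simp_all
      then show "\<phi> a k \<le> \<phi> (Sup S - d) k" using k by (simp add: d_def min_def split: if_splits)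
    qed
  qed
  then have "d \<le> 0" by simp
  then show ?thesis unfolding d_def by (simp only: diff_le_0_iff_le)
qed

subsection \<open>Bands and components\<close>

lemma disjoint_iff: "inf \<bar>x\<bar> \<bar>y\<bar> = 0 \<longleftrightarrow> (\<forall>k\<in>K. \<phi> x k = 0 \<or> \<phi> y k = 0)"
proof -
  have "inf \<bar>x\<bar> \<bar>y\<bar> = 0 \<longleftrightarrow> (\<forall>k\<in>K. \<phi> (inf \<bar>x\<bar> \<bar>y\<bar>) k = \<phi> 0 k)" by (rule yosida_map_eq_iff)
  also have "\<dots> \<longleftrightarrow> (\<forall>k\<in>K. \<phi> x k = 0 \<or> \<phi> y k = 0)" by (rule ball_cong) (auto simp: min_def)
  finally show ?thesis .
qed

lemma mem_disjoint_complement: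
  fixes B :: "'a set"
  shows
  "y \<in> disjoint_complement B \<longleftrightarrow> (\<forall>x\<in>B. \<forall>k\<in>K. \<phi> x k = 0 \<or> \<phi> y k = 0)"
  by (simp add: disjoint_complement_def disjoint_iff)

lemma order_ideal_disjoint_complement: "order_ideal (disjoint_complement (B :: 'a set))"
  unfolding order_ideal_def subspace_def
proof (intro conjI ballI allI impI)
  fix x y assume x: "x \<in> disjoint_complement B" and "\<bar>y\<bar> \<le> \<bar>x\<bar>"
  then have "\<bar>\<phi> y k\<bar> \<le> \<bar>\<phi> x k\<bar>" if "k \<in> K" for k
    using yosida_map_mono[of "\<bar>y\<bar>" "\<bar>x\<bar>" k] that by simp
  then show "y \<in> disjoint_complement B" using x unfolding mem_disjoint_complement by force
qed (auto simp: mem_disjoint_complement, force)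

text \<open>Where \<open>x\<close> does not vanish, every member of \<open>S\<close> is zero, which
  bounds \<open>Sup S\<close> from below; the bound from above is \<open>inf_cSup_le\<close> with
  the modulus of \<open>x\<close>.\<close>

lemma band_disjoint_complement: "band (disjoint_complement (B :: 'a set))"
  unfolding band_def
proof (intro conjI allI impI order_ideal_disjoint_complement)
  fix S assume S: "S \<subseteq> disjoint_complement B" and "S \<noteq> {} \<and> bdd_above S"
  then have ne: "S \<noteq> {}" and bdd: "bdd_above S" by auto
  show "Sup S \<in> disjoint_complement B"
    unfolding mem_disjoint_complement
  proof (intro ballI)
    fix x k assume x: "x \<in> B" and k: "k \<in> K"
    have zero: "\<phi> x k = 0 \<or> \<phi> s k = 0" if "s \<in> S" "k \<in> K" for s k
      using subsetD[OF S that(1)] that(2) x unfolding mem_disjoint_complement by blast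
    obtain s where s: "s \<in> S" using ne by blast
    have "inf (Sup S) \<bar>x\<bar> \<le> 0"
    proof (rule inf_cSup_le[OF ne bdd])
      fix a assume "a \<in> S"
      then show "inf a \<bar>x\<bar> \<le> 0" unfolding yosida_map_le_iff using zero[of a] by fastforce
    qed
    from yosida_map_mono[OF this k] have "min (\<phi> (Sup S) k) \<bar>\<phi> x k\<bar> \<le> 0" using k by simp
    moreover have "\<phi> s k \<le> \<phi> (Sup S) k" by (rule yosida_map_mono[OF cSup_upper[OF s bdd] k])
    ultimately show "\<phi> x k = 0 \<or> \<phi> (Sup S) k = 0"
      using zero[OF s k] by (auto simp: min_def split: if_splits)
  qed
qed

text \<open>Two candidates for the \<open>THE\<close> differ by an element of \<open>B\<close> that
  is disjoint from itself, hence zero.\<close>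

lemma band_projection_eqI:
  fixes B :: "'a set"
  assumes "order_ideal B" "b \<in> B" "x - b \<in> disjoint_complement B"
  shows "band_projection B x = b"
  unfolding band_projection_def
proof (rule the_equality)
  fix c assume c: "c \<in> B \<and> x - c \<in> disjoint_complement B"
  have "subspace B" "subspace (disjoint_complement B)"
    using assms(1) order_ideal_disjoint_complement by (auto simp: order_ideal_def)
  then have "c - b \<in> B" "(x - b) - (x - c) \<in> disjoint_complement B"
    using c assms(2,3) subspace_diff by blast+
  moreover have "(x - b) - (x - c) = c - b" by simp
  ultimately have "c - b \<in> B" "c - b \<in> disjoint_complement B" by simp_all
  then have "\<phi> (c - b) k = 0" if "k \<in> K" for k
    using that unfolding mem_disjoint_complement by fastforce
  then show "c = b" by (intro yosida_map_eqI) auto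
qed (use assms in auto)

text \<open>Equivalent to \<open>inf e (u - e) = 0\<close>; these are the indicator functions of the
  clopen subsets of \<open>K\<close>.\<close>

definition component :: "'a \<Rightarrow> bool" where
  "component e \<longleftrightarrow> (\<forall>k\<in>K. \<phi> e k \<in> {0, 1})"

text \<open>Independence is stated for band projections, so components must be turned into such.
  Multiplication by the indicator \<open>e\<close> projects onto the elements that vanish wherever
  \<open>e\<close> does; written as a disjoint complement, this set is at once a band.\<close>

lemma component_band_projection:
  assumes e: "component e"
  obtains P where "is_band_projection P" "\<And>q. component q \<Longrightarrow> P q = inf e q"
proof
  let ?B = "disjoint_complement {u - e}"
  show "is_band_projection (band_projection ?B)"
    using band_disjoint_complement by (auto simp: is_band_projection_def)
  fix q assume q: "component q"
  show "band_projection ?B q = inf e q"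
  proof (rule band_projection_eqI[OF order_ideal_disjoint_complement])
    show "inf e q \<in> ?B"
      using e q unfolding mem_disjoint_complement component_def by fastforce
    show "q - inf e q \<in> disjoint_complement ?B"
      unfolding mem_disjoint_complement
    proof (intro ballI)
      fix x k assume x: "x \<in> ?B" and k: "k \<in> K"
      then have "\<phi> (u - e) k = 0 \<or> \<phi> x k = 0" by (auto simp: mem_disjoint_complement)
      then show "\<phi> x k = 0 \<or> \<phi> (q - inf e q) k = 0"
        using k q unfolding component_def by fastforce
    qed
  qed
qed

lemma component_unit: "component u"
  by (simp add: component_def)

lemma inf_component: "component e \<Longrightarrow> component q \<Longrightarrow> inf e q = riesz_mult u e q"
  by (rule yosida_map_eqI) (fastforce simp: component_def)

text \<open>The component of \<open>u\<close> in the band generated by \<open>w \<ge> 0\<close>.\<close>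

definition carrier :: "'a \<Rightarrow> 'a" where
  "carrier w = Sup (range (\<lambda>n::nat. inf (real n *\<^sub>R w) u))"

lemma carrier_bdd: "bdd_above (range (\<lambda>n::nat. inf (real n *\<^sub>R w) u))"
  by (rule bdd_aboveI[of _ u]) auto

lemma carrier_upper: "inf (real n *\<^sub>R w) u \<le> carrier w"
  unfolding carrier_def by (rule cSup_upper[OF _ carrier_bdd]) simp

lemma carrier_least: "(\<And>n::nat. inf (real n *\<^sub>R w) u \<le> z) \<Longrightarrow> carrier w \<le> z"
  unfolding carrier_def by (rule cSup_least) auto

lemma carrier_nonneg: "k \<in> K \<Longrightarrow> 0 \<le> \<phi> (carrier w) k"
  using yosida_map_mono[OF carrier_upper[of 0 w], of k] by simp

lemma carrier_le_one: "k \<in> K \<Longrightarrow> \<phi> (carrier w) k \<le> 1"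
  using yosida_map_mono[OF carrier_least[of w u], of k] by simp

lemma carrier_eq_one:
  assumes "k \<in> K" "\<phi> w k > 0"
  shows "\<phi> (carrier w) k = 1"
proof -
  obtain n :: nat where "1 < real n * \<phi> w k" using assms(2) reals_Archimedean3 by blast
  then have "1 \<le> \<phi> (carrier w) k"
    using yosida_map_mono[OF carrier_upper[of n w] assms(1)] assms(1) by simp
  then show ?thesis using carrier_le_one[OF assms(1), of w] by simp
qed

text \<open>Being continuous, \<open>carrier w\<close> is 1 on the closure of the set
  \<open>w > 0\<close>, so it can be nonzero where \<open>w\<close> vanishes. A disjoint
  \<open>z\<close> with \<open>\<phi> z k \<noteq> 0\<close> certifies that \<open>k\<close> is off
  this closure.\<close>

lemma carrier_eq_zero:
  assumes "0 \<le> w" "k \<in> K" "\<phi> z k \<noteq> 0" "inf \<bar>w\<bar> \<bar>z\<bar> = 0"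
  shows "\<phi> (carrier w) k = 0"
proof -
  have "inf (carrier w) \<bar>z\<bar> \<le> 0"
    unfolding carrier_def
  proof (rule inf_cSup_le[OF _ carrier_bdd])
    fix a assume "a \<in> range (\<lambda>n::nat. inf (real n *\<^sub>R w) u)"
    then obtain n :: nat where a: "a = inf (real n *\<^sub>R w) u" by blast
    show "inf a \<bar>z\<bar> \<le> 0"
      unfolding yosida_map_le_iff a
    proof
      fix k assume k: "k \<in> K"
      have "\<phi> w k = 0 \<or> \<phi> z k = 0" using assms(4) k by (simp add: disjoint_iff)
      then show "\<phi> (inf (inf (real n *\<^sub>R w) u) \<bar>z\<bar>) k \<le> \<phi> 0 k" using k by auto
    qed
  qed simp
  from yosida_map_mono[OF this assms(2)] show ?thesis
    using carrier_nonneg[OF assms(2), of w] assms(2,3) by (simp add: min_def split: if_splits)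
qed

lemma component_carrier:
  assumes "0 \<le> w"
  shows "component (carrier w)"
proof -
  let ?p = "carrier w"
  \<comment> \<open>\<open>y \<le> p\<close> with \<open>0 \<le> p \<le> u\<close> forces \<open>p\<close> to take only the values \<open>0\<close> and \<open>1\<close>.\<close>
  define y where "y = inf (2 *\<^sub>R ?p) u"
  \<comment> \<open>The term with doubled index is still below the supremum \<open>p\<close>. This
    leaves room to lower \<open>p\<close> by half of \<open>y - p\<close> and remain an upper bound,
    whence \<open>y \<le> p\<close>.\<close>
  have key: "min a 1 \<le> p - (1/2) * (min (2 * p) 1 - p)" if "0 \<le> a" "min (2 * a) 1 \<le> p" for a p :: real
    using that by (simp add: min_def field_simps split: if_splits)
  have "?p \<le> ?p - (1/2) *\<^sub>R (y - ?p)"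
  proof (rule carrier_least)
    fix n :: nat
    let ?s = "inf (real n *\<^sub>R w) u"
    show "?s \<le> ?p - (1/2) *\<^sub>R (y - ?p)"
      unfolding yosida_map_le_iff
    proof
      fix k assume k: "k \<in> K"
      have "0 \<le> \<phi> w k" using yosida_map_mono[OF assms k] k by simp
      then have "0 \<le> real n * \<phi> w k" by simp
      moreover have "min (2 * (real n * \<phi> w k)) 1 \<le> \<phi> ?p k"
        using yosida_map_mono[OF carrier_upper[of "2 * n" w] k] k by (simp add: mult.assoc)
      ultimately show "\<phi> ?s k \<le> \<phi> (?p - (1/2) *\<^sub>R (y - ?p)) k"
        using key[of "real n * \<phi> w k" "\<phi> ?p k"] k unfolding y_def by simp
    qed
  qed
  then have "\<phi> ?p k \<in> {0, 1}" if "k \<in> K" for k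
    using yosida_map_mono[of ?p "?p - (1/2) *\<^sub>R (y - ?p)" k] that
      carrier_nonneg[OF that, of w] carrier_le_one[OF that, of w]
    by (auto simp: y_def min_def split: if_splits)
  then show ?thesis by (simp add: component_def)
qed

lemma subset_band_generated: "S \<subseteq> band_generated S"
  by (auto simp: band_generated_def)

lemma band_Inter:
  assumes "\<And>B. B \<in> \<B> \<Longrightarrow> band (B :: 'b::dedekind_complete_riesz_space set)"
  shows "band (\<Inter>\<B>)"
  unfolding band_def order_ideal_def
proof (intro conjI allI ballI impI)
  show "subspace (\<Inter>\<B>)"
    using assms by (intro subspace_Inter) (auto simp: band_def order_ideal_def)
next
  fix x y assume "x \<in> \<Inter>\<B>" "\<bar>y\<bar> \<le> \<bar>x\<bar>"
  then show "y \<in> \<Inter>\<B>" using assms unfolding band_def order_ideal_def by blast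
next
  fix A assume "A \<subseteq> \<Inter>\<B>" "A \<noteq> {} \<and> bdd_above A"
  then show "Sup A \<in> \<Inter>\<B>" using assms unfolding band_def by (simp add: le_Inf_iff)
qed

lemma band_band_generated: "band (band_generated S)"
  unfolding band_generated_def by (rule band_Inter) simp

text \<open>\<open>carrier w\<close> is a supremum of elements of the band. Since
  \<open>u - carrier w\<close> vanishes where \<open>w > 0\<close>, \<open>w\<close> lies in the
  band \<open>disjoint_complement {u - carrier w}\<close>, which therefore contains all of
  \<open>band_generated {w}\<close>.\<close>

lemma band_projection_band_generated:
  assumes w: "0 \<le> w"
  shows "band_projection (band_generated {w}) u = carrier w"
proof (rule band_projection_eqI)
  let ?B = "band_generated {w}"
  show ideal: "order_ideal ?B" using band_band_generated by (auto simp: band_def)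
  have wB: "w \<in> ?B" using subset_band_generated by blast
  have "inf (real n *\<^sub>R w) u \<in> ?B" for n :: nat
  proof -
    have "real n *\<^sub>R w \<in> ?B" using ideal wB by (auto simp: order_ideal_def subspace_scale)
    moreover have "\<bar>inf (real n *\<^sub>R w) u\<bar> \<le> \<bar>real n *\<^sub>R w\<bar>"
      unfolding yosida_map_le_iff
    proof
      fix k assume k: "k \<in> K"
      have "0 \<le> real n * \<phi> w k" using yosida_map_mono[OF w k] k by simp
      then show "\<phi> \<bar>inf (real n *\<^sub>R w) u\<bar> k \<le> \<phi> \<bar>real n *\<^sub>R w\<bar> k" using k by simp
    qed
    ultimately show ?thesis using ideal unfolding order_ideal_def by blast
  qed
  then have "range (\<lambda>n::nat. inf (real n *\<^sub>R w) u) \<subseteq> ?B" by blast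
  then show "carrier w \<in> ?B"
    using band_band_generated[of "{w}"] carrier_bdd[of w] unfolding carrier_def band_def by blast
  have "\<phi> (u - carrier w) k = 0 \<or> \<phi> w k = 0" if k: "k \<in> K" for k
    using carrier_eq_one[OF k, of w] yosida_map_mono[OF w k] k by force
  then have "w \<in> disjoint_complement {u - carrier w}" by (simp add: mem_disjoint_complement)
  then have "?B \<subseteq> disjoint_complement {u - carrier w}"
    using band_disjoint_complement unfolding band_generated_def by blast
  then have "x \<in> disjoint_complement {u - carrier w}" if "x \<in> ?B" for x
    using that by blast
  then show "u - carrier w \<in> disjoint_complement ?B"
    by (auto simp: mem_disjoint_complement simp del: yosida_map_simps yosida_map_diff)
qed

subsection \<open>Closed Riesz subspaces\<close>

text \<open>A sequence enters the filter definition as an image of \<open>sequentially\<close>, with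
  \<open>range d\<close> as dominating set. The second assumption in \<open>d\<close> bounds its
  infimum above by 0; the bound below comes from \<open>near\<close>.\<close>

lemma order_closed_sequence:
  fixes s d :: "nat \<Rightarrow> 'a"
  assumes E: "order_closed E" and s: "\<And>n. s n \<in> E" and near: "\<And>n. \<bar>s n - l\<bar> \<le> d n"
    and d: "decseq d" "\<And>z. (\<And>n. z \<le> d n) \<Longrightarrow> z \<le> 0"
  shows "l \<in> E"
proof -
  let ?F = "filtermap s sequentially"
  have nonneg: "0 \<le> d n" for n
    unfolding yosida_map_le_iff using yosida_map_mono[OF near[of n]] by fastforce
  have "decreases_to_zero (range d)"
    unfolding decreases_to_zero_def
  proof (intro conjI ballI)
    show "bdd_below (range d)" using nonneg by (auto intro!: bdd_belowI[of _ 0])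
    then have "Inf (range d) \<le> d n" for n by (intro cInf_lower) auto
    then have "Inf (range d) \<le> 0" by (rule d(2))
    moreover have "0 \<le> Inf (range d)" using nonneg by (intro cInf_greatest) auto
    ultimately show "Inf (range d) = 0" by (rule antisym)
    fix x y assume "x \<in> range d" "y \<in> range d"
    then obtain m n where "x = d m" "y = d n" by blast
    then show "\<exists>z\<in>range d. z \<le> x \<and> z \<le> y"
      using decseqD[OF d(1), of m "max m n"] decseqD[OF d(1), of n "max m n"] by auto
  qed simp
  moreover have "\<forall>e\<in>range d. eventually (\<lambda>x. \<bar>x - l\<bar> \<le> e) ?F"
  proof
    fix e assume "e \<in> range d"
    then obtain m where m: "e = d m" by blast
    have "\<bar>s n - l\<bar> \<le> d m" if "m \<le> n" for n
      using near[of n] decseqD[OF d(1) that] by (rule order_trans)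
    then show "eventually (\<lambda>x. \<bar>x - l\<bar> \<le> e) ?F"
      unfolding m eventually_filtermap eventually_sequentially by blast
  qed
  ultimately have "order_tendsto (\<lambda>x. x) l ?F" unfolding order_tendsto_def by blast
  moreover have "eventually (\<lambda>x. x \<in> E) ?F" by (simp add: eventually_filtermap s)
  moreover have "?F \<noteq> bot" by (simp add: filtermap_bot_iff)
  ultimately show ?thesis using E unfolding order_closed_def by blast
qed

lemma order_closed_uniform:
  assumes E: "order_closed E" and near: "\<And>e. e > 0 \<Longrightarrow> \<exists>y\<in>E. \<forall>k\<in>K. \<bar>\<phi> y k - \<phi> x k\<bar> \<le> e"
  shows "x \<in> E"
proof -
  have "\<exists>y\<in>E. \<forall>k\<in>K. \<bar>\<phi> y k - \<phi> x k\<bar> \<le> inverse (real (Suc n))" for n by (rule near) simp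
  then obtain s where s: "\<And>n. s n \<in> E" "\<And>n. \<forall>k\<in>K. \<bar>\<phi> (s n) k - \<phi> x k\<bar> \<le> inverse (real (Suc n))"
    by metis
  show ?thesis
  proof (rule order_closed_sequence[OF E s(1)])
    let ?d = "\<lambda>n. inverse (real (Suc n)) *\<^sub>R u"
    show "\<bar>s n - x\<bar> \<le> ?d n" for n unfolding yosida_map_le_iff using s(2)[of n] by simp
    show "decseq ?d"
    proof (rule decseq_SucI)
      fix n show "?d (Suc n) \<le> ?d n"
        using unit by (intro scaleR_right_mono) (auto simp: strong_order_unit_def field_simps)
    qed
    fix z assume z: "\<And>n. z \<le> ?d n"
    show "z \<le> 0"
      unfolding yosida_map_le_iff
    proof
      fix k assume k: "k \<in> K"
      show "\<phi> z k \<le> \<phi> 0 k"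
      proof (rule ccontr)
        assume "\<not> \<phi> z k \<le> \<phi> 0 k"
        then have "0 < \<phi> z k" using k by simp
        then obtain n where "inverse (real (Suc n)) < \<phi> z k" using reals_Archimedean by blast
        then show False using yosida_map_mono[OF z[of n] k] k by simp
      qed
    qed
  qed
qed

text \<open>The truncated multiples of \<open>w\<close> increase to \<open>carrier w\<close> in
  order but in general not uniformly, so closedness under order convergence is essential
  here.\<close>

lemma carrier_mem:
  assumes E: "closed_riesz_subspace E" and "u \<in> E" "w \<in> E" and w: "0 \<le> w"
  shows "carrier w \<in> E"
proof -
  let ?s = "\<lambda>n::nat. inf (real n *\<^sub>R w) u"
  have "subspace E" using E by (simp add: closed_riesz_subspace_def riesz_subspace_def)
  then have s: "?s n \<in> E" for n
    using E assms(2,3) by (simp add: closed_riesz_subspace_def riesz_subspace_def subspace_scale)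
  show ?thesis
  proof (rule order_closed_sequence[OF _ s])
    show "order_closed E" using E by (simp add: closed_riesz_subspace_def)
    have "\<bar>y - z\<bar> \<le> z - y" if "y \<le> z" for y z :: 'a
      unfolding yosida_map_le_iff using yosida_map_mono[OF that] by simp
    then show "\<bar>?s n - carrier w\<bar> \<le> carrier w - ?s n" for n using carrier_upper by blast
    show "decseq (\<lambda>n. carrier w - ?s n)"
      unfolding decseq_def
    proof (intro allI impI)
      fix m n :: nat assume "m \<le> n"
      have "real m *\<^sub>R w \<le> real n *\<^sub>R w" using w \<open>m \<le> n\<close> by (intro scaleR_right_mono) auto
      then have "?s m \<le> ?s n" by (rule inf_mono) simp
      then show "carrier w - ?s n \<le> carrier w - ?s m" by (rule diff_left_mono)
    qed
    fix z assume "\<And>n. z \<le> carrier w - ?s n"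
    then have "?s n \<le> carrier w - z" for n by (metis le_diff_eq add.commute)
    then have "carrier w \<le> carrier w - z" by (rule carrier_least)
    then show "z \<le> 0" by simp
  qed
qed

text \<open>The tangent lines of \<open>exp\<close> exhibit \<open>exp x\<close> as a supremum of affine functions of \<open>x\<close>.\<close>

lemma exp_mem:
  assumes E: "closed_riesz_subspace E" and uE: "u \<in> E" and xE: "x \<in> E"
  shows "riesz_exp u x \<in> E"
proof (rule order_closed_uniform)
  show "order_closed E" using E by (simp add: closed_riesz_subspace_def)
  have sub: "subspace E" and sup: "\<And>y z. y \<in> E \<Longrightarrow> z \<in> E \<Longrightarrow> sup y z \<in> E"
    using E by (auto simp: closed_riesz_subspace_def riesz_subspace_def)
  fix e :: real assume "e > 0"
  let ?A = "{y \<in> E. \<forall>k\<in>K. \<phi> y k \<le> exp (\<phi> x k)}"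
  \<comment> \<open>Compactness merges tangents at single points into one member of
    \<open>?A\<close> that is within \<open>e\<close> of the exponential on all of
    \<open>K\<close>.\<close>
  have "\<exists>y\<in>?A. \<forall>k\<in>K. \<phi> (riesz_exp u x - e *\<^sub>R u) k < \<phi> y k"
  proof (rule compact_directed_dominates[OF compact_K])
    have "0 \<in> ?A" using subspace_0[OF sub] by simp
    then show "?A \<noteq> {}" by blast
    show "\<exists>z\<in>?A. \<forall>k\<in>K. max (\<phi> y k) (\<phi> y' k) \<le> \<phi> z k" if "y \<in> ?A" "y' \<in> ?A" for y y'
      using that sup by (intro bexI[of _ "sup y y'"]) auto
    fix l assume l: "l \<in> K"
    define a where "a = \<phi> x l"
    define y where "y = exp a *\<^sub>R (x + (1 - a) *\<^sub>R u)"
    have "y \<in> E" unfolding y_def using sub uE xE by (intro subspace_scale subspace_add)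
    moreover have "\<phi> y k \<le> exp (\<phi> x k)" if "k \<in> K" for k
    proof -
      have "exp a * (1 + (\<phi> x k - a)) \<le> exp a * exp (\<phi> x k - a)"
        by (intro mult_left_mono exp_ge_add_one_self) simp
      then show ?thesis using that by (simp add: y_def mult_exp_exp algebra_simps)
    qed
    moreover have "\<phi> (riesz_exp u x - e *\<^sub>R u) l < \<phi> y l" using l \<open>e > 0\<close> by (simp add: y_def a_def)
    ultimately show "\<exists>y\<in>?A. \<phi> (riesz_exp u x - e *\<^sub>R u) l < \<phi> y l" by blast
  qed (rule continuous_yosida_map)+
  then obtain y where "y \<in> ?A" "\<forall>k\<in>K. \<phi> (riesz_exp u x - e *\<^sub>R u) k < \<phi> y k" by blast
  then show "\<exists>y\<in>E. \<forall>k\<in>K. \<bar>\<phi> y k - \<phi> (riesz_exp u x) k\<bar> \<le> e"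
    by (intro bexI[of _ y]) fastforce+
qed

text \<open>Freudenthal's spectral theorem by binary digits: subtracting \<open>(c/2) e\<close>, where \<open>e\<close> is the component
  of \<open>u\<close> on which \<open>x > c/2\<close>, halves the range of \<open>x\<close>.\<close>

lemma component_approximation_nonneg:
  assumes E: "closed_riesz_subspace E" and uE: "u \<in> E"
  shows "x \<in> E \<Longrightarrow> \<forall>k\<in>K. 0 \<le> \<phi> x k \<and> \<phi> x k \<le> c \<Longrightarrow>
    \<exists>s\<in>span {e \<in> E. component e}. \<forall>k\<in>K. 0 \<le> \<phi> (x - s) k \<and> \<phi> (x - s) k \<le> c / 2 ^ n"
proof (induction n arbitrary: x c)
  case 0
  then show ?case by (intro bexI[of _ 0]) (auto simp: span_zero)
next
  case (Suc n)
  have sub: "subspace E" and sup: "\<And>y z. y \<in> E \<Longrightarrow> z \<in> E \<Longrightarrow> sup y z \<in> E"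
    using E by (auto simp: closed_riesz_subspace_def riesz_subspace_def)
  define w where "w = sup (x - (c/2) *\<^sub>R u) 0"
  define e where "e = carrier w"
  have w: "0 \<le> w" by (simp add: w_def)
  have "w \<in> E" unfolding w_def using sub uE Suc.prems(1)
    by (intro sup subspace_diff subspace_scale subspace_0)
  then have e: "e \<in> E" "component e"
    unfolding e_def using carrier_mem[OF E uE _ w] component_carrier[OF w] by auto
  \<comment> \<open>The positive part of \<open>(c/2) *\<^sub>R u - x\<close> certifies
    \<open>e = 0\<close> where \<open>x < c/2\<close>. Where \<open>x = c/2\<close>, either value of
    \<open>e\<close> keeps the remainder in range.\<close>
  have disj: "inf \<bar>w\<bar> \<bar>sup ((c/2) *\<^sub>R u - x) 0\<bar> = 0" unfolding disjoint_iff by (auto simp: w_def)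
  have "0 \<le> \<phi> (x - (c/2) *\<^sub>R e) k \<and> \<phi> (x - (c/2) *\<^sub>R e) k \<le> c / 2" if k: "k \<in> K" for k
  proof -
    have "\<phi> e k = 1" if "\<phi> x k > c/2"
      unfolding e_def using k that by (intro carrier_eq_one) (auto simp: w_def)
    moreover have "\<phi> e k = 0" if "\<phi> x k < c/2"
      unfolding e_def using k that by (intro carrier_eq_zero[OF w k _ disj]) auto
    moreover have "\<phi> e k = 0 \<or> \<phi> e k = 1" using e(2) k by (auto simp: component_def)
    ultimately show ?thesis using Suc.prems(2)[rule_format, OF k] k
      by (cases "\<phi> x k" "c/2" rule: linorder_cases) auto
  qed
  moreover have "x - (c/2) *\<^sub>R e \<in> E" using sub e(1) Suc.prems(1) by (intro subspace_diff subspace_scale)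
  ultimately obtain s where s: "s \<in> span {e \<in> E. component e}"
    "\<forall>k\<in>K. 0 \<le> \<phi> (x - (c/2) *\<^sub>R e - s) k \<and> \<phi> (x - (c/2) *\<^sub>R e - s) k \<le> c / 2 / 2 ^ n"
    using Suc.IH[of "x - (c/2) *\<^sub>R e" "c/2"] by blast
  have "(c/2) *\<^sub>R e + s \<in> span {e \<in> E. component e}"
    using span_add[OF span_scale[OF span_base] s(1)] e by blast
  moreover have "x - ((c/2) *\<^sub>R e + s) = x - (c/2) *\<^sub>R e - s" by (simp add: algebra_simps)
  ultimately show ?case using s(2) by (intro bexI[of _ "(c/2) *\<^sub>R e + s"]) (simp_all only:, simp)
qed

text \<open>Adding a multiple of \<open>u\<close> makes \<open>x\<close> nonnegative; it can be
  subtracted afterwards because \<open>u\<close> is itself a component in \<open>E\<close>.\<close>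

lemma component_approximation:
  assumes E: "closed_riesz_subspace E" and uE: "u \<in> E" and xE: "x \<in> E" and "\<epsilon> > 0"
  obtains s where "s \<in> span {e \<in> E. component e}" "\<And>k. k \<in> K \<Longrightarrow> \<bar>\<phi> x k - \<phi> s k\<bar> \<le> \<epsilon>"
proof -
  obtain b where b: "b \<ge> 0" "\<And>k. k \<in> K \<Longrightarrow> \<bar>\<phi> x k\<bar> \<le> b" using yosida_map_bounded[of x] by blast
  obtain n where n: "2 * b / \<epsilon> < 2 ^ n" using real_arch_pow[of 2 "2 * b / \<epsilon>"] by auto
  have "x + b *\<^sub>R u \<in> E"
    using E uE xE by (auto simp: closed_riesz_subspace_def riesz_subspace_def intro: subspace_add subspace_scale)
  moreover have "\<forall>k\<in>K. 0 \<le> \<phi> (x + b *\<^sub>R u) k \<and> \<phi> (x + b *\<^sub>R u) k \<le> 2 * b"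
    using b(2) by (force simp: abs_le_iff)
  ultimately obtain s where s: "s \<in> span {e \<in> E. component e}"
    "\<forall>k\<in>K. 0 \<le> \<phi> (x + b *\<^sub>R u - s) k \<and> \<phi> (x + b *\<^sub>R u - s) k \<le> 2 * b / 2 ^ n"
    using component_approximation_nonneg[OF E uE, of "x + b *\<^sub>R u" "2 * b" n] by blast
  have "2 * b / 2 ^ n \<le> \<epsilon>" using n \<open>\<epsilon> > 0\<close> by (simp add: field_simps)
  then have "\<bar>\<phi> x k - \<phi> (s - b *\<^sub>R u) k\<bar> \<le> \<epsilon>" if "k \<in> K" for k
    using s(2)[rule_format, OF that] that by simp
  moreover have "s - b *\<^sub>R u \<in> span {e \<in> E. component e}"
    using span_diff[OF s(1) span_scale[OF span_base]] uE component_unit by blast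
  ultimately show ?thesis using that by blast
qed

section \<open>Algebraic identities for the product and the exponential\<close>

lemma riesz_mult_commute: "riesz_mult u x y = riesz_mult u y x"
  by (rule yosida_map_eqI) (simp add: mult.commute)

lemma riesz_mult_add: "riesz_mult u (x + y) z = riesz_mult u x z + riesz_mult u y z"
  by (rule yosida_map_eqI) (simp add: distrib_right)

lemma riesz_mult_scale: "riesz_mult u (c *\<^sub>R x) z = c *\<^sub>R riesz_mult u x z"
  by (rule yosida_map_eqI) simp

lemma riesz_mult_zero: "riesz_mult u 0 z = 0"
  by (rule yosida_map_eqI) simp

lemma riesz_exp_add: "riesz_exp u (x + y) = riesz_mult u (riesz_exp u x) (riesz_exp u y)"
  by (rule yosida_map_eqI) (simp add: exp_add)

lemma riesz_exp_zero: "riesz_exp u 0 = u"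
  by (rule yosida_map_eqI) simp

lemma riesz_exp_diff_unit: "riesz_exp u (x - c *\<^sub>R u) = exp (- c) *\<^sub>R riesz_exp u x"
  by (rule yosida_map_eqI) (simp add: exp_diff exp_minus field_simps)

end

lemma closed_riesz_subspace_generated:
  "closed_riesz_subspace (closed_riesz_subspace_generated S)"
proof -
  let ?\<E> = "{E. closed_riesz_subspace E \<and> S \<subseteq> E}"
  have "subspace (\<Inter>?\<E>)"
    by (rule subspace_Inter) (auto simp: closed_riesz_subspace_def riesz_subspace_def)
  moreover have "order_closed (\<Inter>?\<E>)"
    unfolding order_closed_def
  proof (intro allI impI)
    fix F l assume F: "F \<noteq> bot \<and> eventually (\<lambda>x. x \<in> \<Inter>?\<E>) F \<and> order_tendsto (\<lambda>x. x) l F"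
    show "l \<in> \<Inter>?\<E>"
    proof
      fix E assume E: "E \<in> ?\<E>"
      have "eventually (\<lambda>x. x \<in> E) F"
        using F E by (auto elim: eventually_mono)
      then show "l \<in> E" using F E unfolding closed_riesz_subspace_def order_closed_def by blast
    qed
  qed
  ultimately show ?thesis
    unfolding closed_riesz_subspace_generated_def closed_riesz_subspace_def[of "\<Inter>?\<E>"] riesz_subspace_def[of "\<Inter>?\<E>"]
    by (auto simp: closed_riesz_subspace_def riesz_subspace_def)
qed

lemma closed_riesz_subspace_generated_superset: "S \<subseteq> closed_riesz_subspace_generated S"
  by (auto simp: closed_riesz_subspace_generated_def)

section \<open>Unital positive operators\<close>

locale order_unit_expectation = order_unit_space +
  fixes T :: "'a \<Rightarrow> 'a"
  assumes linear: "linear T" and positive: "0 \<le> x \<Longrightarrow> 0 \<le> T x" and unital: "T u = u"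
begin

lemma T_mono: "x \<le> y \<Longrightarrow> T x \<le> T y"
  using positive[of "y - x"] by (simp add: linear_diff[OF linear])

lemma T_contractive:
  assumes "\<And>k. k \<in> K \<Longrightarrow> \<bar>\<phi> x k\<bar> \<le> b" "k \<in> K"
  shows "\<bar>\<phi> (T x) k\<bar> \<le> b"
proof -
  have "x \<le> b *\<^sub>R u" "(- b) *\<^sub>R u \<le> x" unfolding yosida_map_le_iff using assms(1) by (force simp: abs_le_iff)+
  then have "T x \<le> b *\<^sub>R u" "(- b) *\<^sub>R u \<le> T x"
    using T_mono unital by (metis linear_scale[OF linear])+
  from this[THEN yosida_map_mono, OF assms(2)] show ?thesis using assms(2) by simp
qed

section \<open>Multiplicativity of \<open>T\<close> on independent subspaces\<close>

lemma multiplicative_limit: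
  assumes "\<And>\<epsilon>. \<epsilon> > 0 \<Longrightarrow> \<exists>s. (\<forall>k\<in>K. \<bar>\<phi> f k - \<phi> s k\<bar> \<le> \<epsilon>) \<and>
    T (riesz_mult u s g) = riesz_mult u (T s) (T g)"
  shows "T (riesz_mult u f g) = riesz_mult u (T f) (T g)"
proof (rule yosida_map_eqI)
  fix k assume k: "k \<in> K"
  obtain b where b: "b \<ge> 0" "\<And>k. k \<in> K \<Longrightarrow> \<bar>\<phi> g k\<bar> \<le> b" using yosida_map_bounded[of g] by blast
  let ?L = "\<phi> (T (riesz_mult u f g)) k" and ?R = "\<phi> (riesz_mult u (T f) (T g)) k"
  have "\<bar>?L - ?R\<bar> \<le> 0 + \<epsilon>" if "\<epsilon> > 0" for \<epsilon>
  proof -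
    \<comment> \<open>Replacing \<open>f\<close> by \<open>s\<close> costs at most
      \<open>e * b\<close> on each side of the identity; \<open>b + 1\<close> keeps the denominator
      positive when \<open>b = 0\<close>.\<close>
    define e where "e = \<epsilon> / (2 * (b + 1))"
    have e: "e > 0" using that b(1) by (simp add: e_def)
    then obtain s where s: "\<And>k. k \<in> K \<Longrightarrow> \<bar>\<phi> f k - \<phi> s k\<bar> \<le> e"
      "T (riesz_mult u s g) = riesz_mult u (T s) (T g)" using assms by blast
    have "\<bar>\<phi> (riesz_mult u (f - s) g) l\<bar> \<le> e * b" if "l \<in> K" for l
    proof -
      have "\<bar>\<phi> f l - \<phi> s l\<bar> * \<bar>\<phi> g l\<bar> \<le> e * b"
        using s(1)[OF that] b(2)[OF that] e by (intro mult_mono) auto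
      then show ?thesis using that by (simp add: abs_mult)
    qed
    from T_contractive[OF this k] have 1: "\<bar>\<phi> (T (riesz_mult u (f - s) g)) k\<bar> \<le> e * b" .
    have "riesz_mult u f g = riesz_mult u (f - s) g + riesz_mult u s g"
      by (simp flip: riesz_mult_add)
    then have 2: "?L = \<phi> (T (riesz_mult u (f - s) g)) k + \<phi> (T s) k * \<phi> (T g) k"
      using k by (simp add: linear_add[OF linear] s(2))
    have "\<bar>\<phi> (T (f - s)) k\<bar> \<le> e" using s(1) k by (intro T_contractive) auto
    moreover have "\<bar>\<phi> (T g) k\<bar> \<le> b" by (rule T_contractive[OF b(2) k])
    ultimately have 3: "\<bar>\<phi> (T (f - s)) k * \<phi> (T g) k\<bar> \<le> e * b"
      unfolding abs_mult using e by (intro mult_mono) auto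
    have "\<phi> (T (f - s)) k * \<phi> (T g) k = ?R - \<phi> (T s) k * \<phi> (T g) k"
      using k by (simp add: linear_diff[OF linear] left_diff_distrib)
    then have "\<bar>?L - ?R\<bar> \<le> 2 * (e * b)" using 1 2 3 by linarith
    also have "\<dots> \<le> 2 * (e * (b + 1))" using e by (intro mult_left_mono) auto
    also have "\<dots> = \<epsilon>" using b(1) by (simp add: e_def field_simps)
    finally show ?thesis by simp
  qed
  then have "\<bar>?L - ?R\<bar> \<le> 0" by (rule field_le_epsilon)
  then show "?L = ?R" by simp
qed

lemma multiplicative_span:
  assumes "s \<in> span C" "\<And>e. e \<in> C \<Longrightarrow> T (riesz_mult u e g) = riesz_mult u (T e) (T g)"
  shows "T (riesz_mult u s g) = riesz_mult u (T s) (T g)"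
  using assms(1)
proof (induction rule: span_induct_alt)
  case base
  then show ?case by (simp add: riesz_mult_zero linear_0[OF linear])
next
  case (step c x y)
  then show ?case
    by (simp add: riesz_mult_add riesz_mult_scale linear_add[OF linear] linear_scale[OF linear] assms(2))
qed

lemma multiplicative_closed_subspace:
  assumes E: "closed_riesz_subspace E" "u \<in> E" and f: "f \<in> E"
    and C: "\<And>e. e \<in> E \<Longrightarrow> component e \<Longrightarrow> T (riesz_mult u e g) = riesz_mult u (T e) (T g)"
  shows "T (riesz_mult u f g) = riesz_mult u (T f) (T g)"
proof (rule multiplicative_limit)
  fix \<epsilon> :: real assume "\<epsilon> > 0"
  from component_approximation[OF E f this] obtain s
    where "s \<in> span {e \<in> E. component e}" "\<And>k. k \<in> K \<Longrightarrow> \<bar>\<phi> f k - \<phi> s k\<bar> \<le> \<epsilon>" by blast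
  then show "\<exists>s. (\<forall>k\<in>K. \<bar>\<phi> f k - \<phi> s k\<bar> \<le> \<epsilon>) \<and> T (riesz_mult u s g) = riesz_mult u (T s) (T g)"
    using multiplicative_span[of s "{e \<in> E. component e}" g] C by blast
qed

text \<open>One factor is extended at a time: with a component \<open>p\<close> of \<open>E1\<close>
  fixed, from components of \<open>E2\<close> to \<open>g\<close>; then with \<open>g\<close> fixed,
  from components of \<open>E1\<close> to \<open>f\<close>. Commutativity moves the varying factor
  to the left.\<close>

lemma T_mult_cond_indep:
  assumes E1: "closed_riesz_subspace E1" "u \<in> E1" and E2: "closed_riesz_subspace E2" "u \<in> E2"
    and indep: "cond_indep_subspaces u T E1 E2" and f: "f \<in> E1" and g: "g \<in> E2"
  shows "T (riesz_mult u f g) = riesz_mult u (T f) (T g)"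
proof (rule multiplicative_closed_subspace[OF E1 f])
  fix p assume p: "p \<in> E1" "component p"
  have "T (riesz_mult u q p) = riesz_mult u (T q) (T p)" if q: "q \<in> E2" "component q" for q
  proof -
    obtain P where P: "is_band_projection P" "\<And>e. component e \<Longrightarrow> P e = inf p e"
      using component_band_projection[OF p(2)] by blast
    obtain Q where Q: "is_band_projection Q" "\<And>e. component e \<Longrightarrow> Q e = inf q e"
      using component_band_projection[OF q(2)] by blast
    have le: "inf e u = e" if "component e" for e
      by (rule yosida_map_eqI) (use that in \<open>fastforce simp: component_def\<close>)
    have PQ: "P u = p" "Q u = q"
      using P(2)[OF component_unit] Q(2)[OF component_unit] le p(2) q(2) by auto
    then have "cond_indep_projections u T P Q"
      using indep P(1) Q(1) p(1) q(1) unfolding cond_indep_subspaces_def by blast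
    then have "T (riesz_mult u p q) = riesz_mult u (T p) (T q)"
      using P(2)[OF q(2)] inf_component[OF p(2) q(2)] unfolding cond_indep_projections_def PQ by simp
    then show ?thesis by (simp add: riesz_mult_commute)
  qed
  from multiplicative_closed_subspace[OF E2 g this]
  show "T (riesz_mult u p g) = riesz_mult u (T p) (T g)" by (simp add: riesz_mult_commute)
qed

section \<open>Moment generating functions and the Chernoff bound\<close>

text \<open>A bound on the logarithm can be exponentiated only if its argument is strictly positive
  on \<open>K\<close>. Boundedness of the exponent gives a lower bound
  \<open>exp (- b) *\<^sub>R u\<close>, which \<open>T\<close> preserves.\<close>

lemma subgaussian_mgf_le:
  assumes X: "subgaussian u T X v" and k: "k \<in> K"
  shows "\<phi> (T (riesz_exp u (s *\<^sub>R (X - T X)))) k \<le> exp (s\<^sup>2 / 2 * gauge_norm u v)"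
proof -
  let ?Z = "s *\<^sub>R (X - T X)"
  obtain b where b: "\<And>k. k \<in> K \<Longrightarrow> \<bar>\<phi> ?Z k\<bar> \<le> b" using yosida_map_bounded[of ?Z] by blast
  have "exp (- b) *\<^sub>R u \<le> riesz_exp u ?Z"
    unfolding yosida_map_le_iff
  proof
    fix k assume k: "k \<in> K"
    have "- b \<le> \<phi> ?Z k" using b[OF k] by linarith
    then have "exp (- b) \<le> exp (\<phi> ?Z k)" by simp
    then show "\<phi> (exp (- b) *\<^sub>R u) k \<le> \<phi> (riesz_exp u ?Z) k"
      using k by (simp del: exp_le_cancel_iff)
  qed
  from T_mono[OF this] have le: "exp (- b) *\<^sub>R u \<le> T (riesz_exp u ?Z)"
    by (simp add: linear_scale[OF linear] unital)
  have pos: "0 < \<phi> (T (riesz_exp u ?Z)) k" if "k \<in> K" for k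
  proof -
    have "exp (- b) \<le> \<phi> (T (riesz_exp u ?Z)) k" using yosida_map_mono[OF le that] that by simp
    then show ?thesis using exp_gt_zero[of "- b"] by linarith
  qed
  have log: "\<phi> (riesz_log u (T (riesz_exp u ?Z))) k = ln (\<phi> (T (riesz_exp u ?Z)) k)"
    by (rule yosida_map_log[OF pos k])
  have "cond_log_mgf u T (X - T X) s \<le> (s\<^sup>2 / 2) *\<^sub>R v" using X by (simp add: subgaussian_def)
  from yosida_map_mono[OF this k] have "ln (\<phi> (T (riesz_exp u ?Z)) k) \<le> s\<^sup>2 / 2 * \<phi> v k"
    using k by (simp add: cond_log_mgf_def log)
  also have "\<dots> \<le> s\<^sup>2 / 2 * gauge_norm u v"
    using yosida_map_le_gauge_norm[OF k, of v] by (intro mult_left_mono) auto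
  finally show ?thesis using pos[OF k] by (metis exp_le_cancel_iff exp_ln)
qed

text \<open>An invertible \<open>v\<close> vanishes nowhere on \<open>K\<close>. The point
  \<open>k\<close> excludes the case \<open>u = 0\<close>, in which \<open>K\<close> is
  empty.\<close>

lemma subgaussian_gauge_norm_pos:
  assumes "subgaussian u T X v" "k \<in> K"
  shows "0 < gauge_norm u v"
proof -
  obtain y where "riesz_mult u v y = u" using assms(1) by (auto simp: subgaussian_def riesz_invertible_def)
  then have "\<phi> v k * \<phi> y k = 1" using yosida_map_mult[OF assms(2), of v y] assms(2) by simp
  then have "\<phi> v k \<noteq> 0" by auto
  then show ?thesis using yosida_map_le_gauge_norm[OF assms(2), of v] by linarith
qed

lemma T_exp_nonneg: "k \<in> K \<Longrightarrow> 0 \<le> \<phi> (T (riesz_exp u x)) k"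
  using yosida_map_mono[OF positive[of "riesz_exp u x"], of k] by (simp add: yosida_map_le_iff)

text \<open>Induction splits off the last summand: the first \<open>m\<close> summands and the last
  one generate subspaces over disjoint index sets. Keeping \<open>n\<close> fixed lets independence
  of the whole family serve every step.\<close>

lemma mgf_sum_le:
  fixes X v :: "nat \<Rightarrow> 'a"
  assumes indep: "cond_indep_elements u T {1..n} X"
    and sub: "\<And>i. i \<in> {1..n} \<Longrightarrow> subgaussian u T (X i) (v i)"
    and "m \<le> n" and k: "k \<in> K"
  shows "\<phi> (T (riesz_exp u (s *\<^sub>R (\<Sum>i=1..m. X i - T (X i))))) k
    \<le> exp (s\<^sup>2 / 2 * (\<Sum>i=1..m. gauge_norm u (v i)))"
  using \<open>m \<le> n\<close>
proof (induction m)
  case 0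
  then show ?case using k by (simp add: riesz_exp_zero unital)
next
  case (Suc m)
  define E where "E i = closed_riesz_subspace_generated ({X i} \<union> range T)" for i
  define G where "G J = closed_riesz_subspace_generated (\<Union>i\<in>J. E i)" for J
  let ?Y = "\<lambda>i. X i - T (X i)"
  let ?f = "riesz_exp u (s *\<^sub>R (\<Sum>i=1..m. ?Y i))" and ?g = "riesz_exp u (s *\<^sub>R ?Y (Suc m))"
  have closed: "closed_riesz_subspace (G J)" and subG: "subspace (G J)" for J
    using closed_riesz_subspace_generated[of "\<Union>i\<in>J. E i"]
    by (auto simp: G_def closed_riesz_subspace_def riesz_subspace_def)
  have E_sub: "E i \<subseteq> G J" if "i \<in> J" for i J
    unfolding G_def by (rule order_trans[OF UN_upper[OF that] closed_riesz_subspace_generated_superset])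
  have gen: "X i \<in> E i" "T x \<in> E i" for i x
    unfolding E_def using closed_riesz_subspace_generated_superset[of "{X i} \<union> range T"] by blast+
  have Y: "?Y i \<in> G J" if "i \<in> J" for i J
    using E_sub[OF that] gen by (intro subspace_diff[OF subG]) blast+
  have uG: "u \<in> G J" if "i \<in> J" for i J
    using E_sub[OF that] gen(2)[of u i] unital by auto
  have split: "riesz_exp u (s *\<^sub>R (\<Sum>i=1..Suc m. ?Y i)) = riesz_mult u ?f ?g"
    by (simp add: scaleR_add_right riesz_exp_add del: yosida_map_simps)
  have "T (riesz_mult u ?f ?g) = riesz_mult u (T ?f) (T ?g)"
  \<comment> \<open>The subspace generated by the empty family need not contain \<open>u\<close>, so
    \<open>m = 0\<close> is separate; there \<open>?f\<close> is \<open>u\<close>.\<close>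
  proof (cases "m = 0")
    case True
    have "riesz_mult u u x = x" for x by (rule yosida_map_eqI) simp
    then show ?thesis using True by (simp add: riesz_exp_zero unital)
  next
    case False
    show ?thesis
    proof (rule T_mult_cond_indep)
      show "closed_riesz_subspace (G {1..m})" "closed_riesz_subspace (G {Suc m})" by (rule closed)+
      show u1: "u \<in> G {1..m}" using False by (intro uG[of 1]) simp
      show u2: "u \<in> G {Suc m}" by (rule uG[of "Suc m"]) simp
      have "{1..m} \<subseteq> {1..n}" "{Suc m} \<subseteq> {1..n}" "{1..m} \<inter> {Suc m} = {}"
        using Suc.prems by auto
      then show "cond_indep_subspaces u T (G {1..m}) (G {Suc m})"
        using indep[unfolded cond_indep_elements_def cond_indep_family_def]
        unfolding G_def E_def by (elim conjE allE[of _ "{1..m}"] allE[of _ "{Suc m}"]) simp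
      have "(\<Sum>i=1..m. ?Y i) \<in> G {1..m}" using Y by (intro subspace_sum[OF subG]) auto
      then show "?f \<in> G {1..m}" using u1 by (intro exp_mem closed subspace_scale[OF subG])
      show "?g \<in> G {Suc m}" using u2 Y by (intro exp_mem closed subspace_scale[OF subG]) simp_all
    qed
  qed
  then have "\<phi> (T (riesz_exp u (s *\<^sub>R (\<Sum>i=1..Suc m. ?Y i)))) k = \<phi> (T ?f) k * \<phi> (T ?g) k"
    unfolding split using k by simp
  also have "\<dots> \<le> exp (s\<^sup>2 / 2 * (\<Sum>i=1..m. gauge_norm u (v i))) * exp (s\<^sup>2 / 2 * gauge_norm u (v (Suc m)))"
  proof (rule mult_mono)
    show "\<phi> (T ?f) k \<le> exp (s\<^sup>2 / 2 * (\<Sum>i=1..m. gauge_norm u (v i)))" using Suc by simp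
    show "\<phi> (T ?g) k \<le> exp (s\<^sup>2 / 2 * gauge_norm u (v (Suc m)))"
      using Suc.prems by (intro subgaussian_mgf_le[OF sub k]) simp
  qed (use T_exp_nonneg[OF k] in auto)
  also have "\<dots> = exp (s\<^sup>2 / 2 * (\<Sum>i=1..Suc m. gauge_norm u (v i)))"
    by (simp add: distrib_left exp_add)
  finally show ?case .
qed

text \<open>Each truncated multiple of \<open>?w\<close> is zero where \<open>x \<le> t\<close> and
  at most 1 elsewhere, where the exponential is at least 1. Comparing these terms avoids evaluating
  their supremum pointwise.\<close>

lemma chernoff:
  assumes "s \<ge> 0"
  shows "T (band_projection (band_generated {pprt (x - t *\<^sub>R u)}) u)
    \<le> exp (- (s * t)) *\<^sub>R T (riesz_exp u (s *\<^sub>R x))"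
proof -
  let ?w = "pprt (x - t *\<^sub>R u)"
  have w: "0 \<le> ?w" by (simp add: pprt_def)
  have "carrier ?w \<le> riesz_exp u (s *\<^sub>R x - (s * t) *\<^sub>R u)"
  proof (rule carrier_least)
    fix n :: nat
    show "inf (real n *\<^sub>R ?w) u \<le> riesz_exp u (s *\<^sub>R x - (s * t) *\<^sub>R u)"
      unfolding yosida_map_le_iff
    proof
      fix k assume k: "k \<in> K"
      have "min (real n * max (\<phi> x k - t) 0) 1 \<le> exp (s * (\<phi> x k - t))"
      proof (cases "\<phi> x k \<le> t")
        case True
        then show ?thesis by simp
      next
        case False
        then have "1 \<le> exp (s * (\<phi> x k - t))" using assms by simp
        then show ?thesis by linarith
      qed
      then show "\<phi> (inf (real n *\<^sub>R ?w) u) k \<le> \<phi> (riesz_exp u (s *\<^sub>R x - (s * t) *\<^sub>R u)) k"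
        using k by (simp add: pprt_def right_diff_distrib)
    qed
  qed
  from T_mono[OF this] show ?thesis
    by (simp add: band_projection_band_generated[OF w] riesz_exp_diff_unit linear_scale[OF linear])
qed

end

theorem theorem7p3:
  fixes u :: "'a::dedekind_complete_riesz_space"
    and T :: "'a \<Rightarrow> 'a"
    and X v :: "nat \<Rightarrow> 'a"
    and n :: nat
    and t :: real
  assumes "strong_order_unit u"
    and "conditional_expectation T"
    and "strictly_positive T"
    and "T u = u"
    and "1 \<le> n"
    and "cond_indep_elements u T {1..n} X"
    and "\<And>i. i \<in> {1..n} \<Longrightarrow> subgaussian u T (X i) (v i)"
    and "t > 0"
  shows "T (band_projection (band_generated {pprt ((\<Sum>i=1..n. X i - T (X i)) - t *\<^sub>R u)}) u)
           \<le> exp (- t\<^sup>2 / (2 * (\<Sum>i=1..n. gauge_norm u (v i)))) *\<^sub>R u"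
proof -
  interpret order_unit_expectation u T
    by (intro order_unit_expectation.intro order_unit_space.intro order_unit_expectation_axioms.intro)
      (use assms(1,2,4) in \<open>simp_all add: conditional_expectation_def\<close>)
  define \<sigma> where "\<sigma> = (\<Sum>i=1..n. gauge_norm u (v i))"
  define x where "x = (\<Sum>i=1..n. X i - T (X i))"
  define p where "p = T (band_projection (band_generated {pprt (x - t *\<^sub>R u)}) u)"
  have "p \<le> exp (- t\<^sup>2 / (2 * \<sigma>)) *\<^sub>R u"
    unfolding yosida_map_le_iff
  proof
    fix k assume k: "k \<in> K"
    \<comment> \<open>The sum is nonempty because \<open>1 \<le> n\<close>. If \<open>K\<close> has
      no point, the pointwise claim is vacuous.\<close>
    have "\<sigma> > 0"
      unfolding \<sigma>_def using assms(5) subgaussian_gauge_norm_pos[OF assms(7) k] by (intro sum_pos) auto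
    \<comment> \<open>This is the minimizer of the exponent
      \<open>s\<^sup>2 / 2 * \<sigma> - s * t\<close>.\<close>
    define s where "s = t / \<sigma>"
    have "s \<ge> 0" using \<open>\<sigma> > 0\<close> assms(8) by (simp add: s_def)
    have "\<phi> p k \<le> exp (- (s * t)) * \<phi> (T (riesz_exp u (s *\<^sub>R x))) k"
      unfolding p_def using yosida_map_mono[OF chernoff[OF \<open>s \<ge> 0\<close>] k] k by simp
    also have "\<dots> \<le> exp (- (s * t)) * exp (s\<^sup>2 / 2 * \<sigma>)"
      unfolding x_def \<sigma>_def by (intro mult_left_mono mgf_sum_le[OF assms(6,7) order_refl k]) auto
    also have "\<dots> = exp (- t\<^sup>2 / (2 * \<sigma>))"
      using \<open>\<sigma> > 0\<close> by (simp add: mult_exp_exp s_def power2_eq_square field_simps)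
    finally show "\<phi> p k \<le> \<phi> (exp (- t\<^sup>2 / (2 * \<sigma>)) *\<^sub>R u) k" using k by simp
  qed
  then show ?thesis by (simp only: p_def x_def \<sigma>_def)
qed

end
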